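(* There exist a Stein manifold $X$ of complex dimension four and a closed complex submanifold $Y\subset X$ of complex dimension two which is homotopy equivalent to the (real) two-sphere, such that $Y$ is a differentiable complete intersection in $X$ but is not a holomorphic complete intersection in $X$.
   Context: A closed complex submanifold $Y$ of complex codimension $d$ in a complex manifold $X$ is a holomorphic complete intersection in $X$ if there exist $d$ holomorphic functions $f_1,\ldots,f_d\in\mathcal{O}(X)$ such that $Y=\{x\in X: f_1(x)=\cdots=f_d(x)=0\}$ and the differentials $df_1(x),\ldots,df_d(x)$ are $\mathbb{C}$-linearly independent at each point $x\in Y$. A smooth real submanifold $Y$ of real codimension $k$ in a smooth manifold $X$ is a differentiable complete intersection in $X$ if there exist $k$ smooth real-valued functions $f_1,\ldots,f_k$ on $X$ such that $Y=\{x\in X: f_1(x)=\cdots=f_k(x)=0\}$ and the differentials $df_1(x),\ldots,df_k(x)$ are $\mathbb{R}$-linearly independent at each point $x\in Y$. A complex submanifold of complex codimension $d$ is regarded here as a smooth real submanifold of real codimension $2d$. *)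

theory Defs
  imports "HOL-Analysis.Analysis"
begin

section \<open>Holomorphic and smooth functions on open subsets of the model space\<close>

definition holomorphic_fun_on :: "(complex^'n \<Rightarrow> complex) \<Rightarrow> (complex^'n) set \<Rightarrow> bool" where
  "holomorphic_fun_on f U \<longleftrightarrow> open U \<and>
     (\<forall>z\<in>U. \<exists>D. (f has_derivative D) (at z) \<and> (\<forall>c v. D (c *s v) = c * D v))"

definition holomorphic_map_on :: "(complex^'n \<Rightarrow> complex^'m) \<Rightarrow> (complex^'n) set \<Rightarrow> bool" where
  "holomorphic_map_on g U \<longleftrightarrow> (\<forall>i. holomorphic_fun_on (\<lambda>z. g z $ i) U)"

text \<open>Meant for open sets and a finite-dimensional domain: by recursion on the order,
  all iterated directional derivatives up to order \<open>k\<close> exist, are Frechet differentiable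
  below order \<open>k\<close>, and are continuous.\<close>

fun C_k_on :: "nat \<Rightarrow> ('e::euclidean_space \<Rightarrow> real) \<Rightarrow> 'e set \<Rightarrow> bool" where
  "C_k_on 0 f U \<longleftrightarrow> continuous_on U f"
| "C_k_on (Suc k) f U \<longleftrightarrow> (\<forall>z\<in>U. f differentiable (at z)) \<and>
     (\<forall>v. C_k_on k (\<lambda>z. frechet_derivative f (at z) v) U)"

section \<open>Charts, complex manifolds, functions and differentials\<close>

text \<open>A chart is a pair of its domain and the coordinate map.  Only the values of the coordinate
  map on the domain matter.\<close>

type_synonym ('a, 'e) chart = "'a set \<times> ('a \<Rightarrow> 'e)"

definition in_chart :: "('a, 'e) chart \<Rightarrow> ('a \<Rightarrow> 'b) \<Rightarrow> 'e \<Rightarrow> 'b" where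
  "in_chart ch f = f \<circ> inv_into (fst ch) (snd ch)"

definition topological_chart :: "'a topology \<Rightarrow> ('a, 'e::topological_space) chart \<Rightarrow> bool" where
  "topological_chart X ch \<longleftrightarrow> openin X (fst ch) \<and> open (snd ch ` fst ch) \<and>
     homeomorphic_map (subtopology X (fst ch)) (top_of_set (snd ch ` fst ch)) (snd ch)"

definition holomorphic_transition :: "('a, complex^'n) chart \<Rightarrow> ('a, complex^'n) chart \<Rightarrow> bool" where
  "holomorphic_transition c1 c2 \<longleftrightarrow>
     holomorphic_map_on (in_chart c1 (snd c2)) (snd c1 ` (fst c1 \<inter> fst c2))"

definition second_countable_topology_space :: "'a topology \<Rightarrow> bool" where
  "second_countable_topology_space X \<longleftrightarrow>
     (\<exists>\<B>. countable \<B> \<and> (\<forall>V\<in>\<B>. openin X V) \<and>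
          (\<forall>U x. openin X U \<and> x \<in> U \<longrightarrow> (\<exists>V\<in>\<B>. x \<in> V \<and> V \<subseteq> U)))"

definition complex_manifold :: "'a topology \<Rightarrow> ('a, complex^'n) chart set \<Rightarrow> bool" where
  "complex_manifold X A \<longleftrightarrow>
     Hausdorff_space X \<and> second_countable_topology_space X \<and>
     (\<forall>ch\<in>A. topological_chart X ch) \<and> \<Union>(fst ` A) = topspace X \<and>
     (\<forall>c1\<in>A. \<forall>c2\<in>A. holomorphic_transition c1 c2)"

text \<open>The charts of the maximal holomorphic atlas containing \<open>A\<close>.\<close>

definition holomorphic_chart :: "'a topology \<Rightarrow> ('a, complex^'n) chart set \<Rightarrow> ('a, complex^'n) chart \<Rightarrow> bool" where
  "holomorphic_chart X A ch \<longleftrightarrow> topological_chart X ch \<and>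
     (\<forall>c\<in>A. holomorphic_transition ch c \<and> holomorphic_transition c ch)"

definition holomorphic_functions :: "('a, complex^'n) chart set \<Rightarrow> ('a \<Rightarrow> complex) set" where
  "holomorphic_functions A =
     {f. \<forall>ch\<in>A. holomorphic_fun_on (in_chart ch f) (snd ch ` fst ch)}"

text \<open>Here and below, charts with values in \<open>complex^'n\<close> double as charts of the
  underlying smooth manifold, \<open>complex^'n\<close> being a real Euclidean space of
  dimension \<open>2 * CARD('n)\<close>.\<close>

definition smooth_functions :: "('a, 'e::euclidean_space) chart set \<Rightarrow> ('a \<Rightarrow> real) set" where
  "smooth_functions A = {f. \<forall>ch\<in>A. \<forall>k. C_k_on k (in_chart ch f) (snd ch ` fst ch)}"

definition differential ::
    "('a, 'e::real_normed_vector) chart \<Rightarrow> ('a \<Rightarrow> 'k::real_normed_vector) \<Rightarrow> 'a \<Rightarrow> 'e \<Rightarrow> 'k" where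
  "differential ch f x = frechet_derivative (in_chart ch f) (at (snd ch x))"

text \<open>Linear independence over \<open>'k\<close> (which is \<open>real\<close> or \<open>complex\<close>) of the
  differentials of \<open>f 0, \<dots>, f (d - 1)\<close> at \<open>x\<close>, expressed in the coordinates
  of the charts around \<open>x\<close>.\<close>

definition independent_differentials ::
    "('a, 'e::real_normed_vector) chart set \<Rightarrow> nat \<Rightarrow> (nat \<Rightarrow> 'a \<Rightarrow> 'k::real_normed_field) \<Rightarrow> 'a \<Rightarrow> bool" where
  "independent_differentials A d f x \<longleftrightarrow>
     (\<forall>ch\<in>A. x \<in> fst ch \<longrightarrow>
        (\<forall>c :: nat \<Rightarrow> 'k. (\<forall>v. (\<Sum>i<d. c i * differential ch (f i) x v) = 0) \<longrightarrow> (\<forall>i<d. c i = 0)))"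

section \<open>Stein manifolds\<close>

definition holomorphic_hull :: "'a topology \<Rightarrow> ('a, complex^'n) chart set \<Rightarrow> 'a set \<Rightarrow> 'a set" where
  "holomorphic_hull X A K =
     {x \<in> topspace X. \<forall>f\<in>holomorphic_functions A. \<forall>r::real.
        (\<forall>y\<in>K. norm (f y) \<le> r) \<longrightarrow> norm (f x) \<le> r}"

text \<open>Holomorphically separable, with local coordinates given by global holomorphic functions,
  and holomorphically convex.\<close>

definition Stein_manifold :: "'a topology \<Rightarrow> ('a, complex^'n) chart set \<Rightarrow> bool" where
  "Stein_manifold X A \<longleftrightarrow> complex_manifold X A \<and>
     (\<forall>x\<in>topspace X. \<forall>y\<in>topspace X. x \<noteq> y \<longrightarrow> (\<exists>f\<in>holomorphic_functions A. f x \<noteq> f y)) \<and>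
     (\<forall>x\<in>topspace X. \<exists>f. (\<forall>i<CARD('n). f i \<in> holomorphic_functions A) \<and>
        independent_differentials A CARD('n) f x) \<and>
     (\<forall>K. compactin X K \<longrightarrow> compactin X (holomorphic_hull X A K))"

section \<open>Submanifolds and complete intersections\<close>

text \<open>The submanifold has complex dimension \<open>k\<close>: in suitable coordinates it is a
  coordinate subspace with \<open>k\<close> free coordinates.\<close>

definition closed_complex_submanifold ::
    "'a topology \<Rightarrow> ('a, complex^'n) chart set \<Rightarrow> nat \<Rightarrow> 'a set \<Rightarrow> bool" where
  "closed_complex_submanifold X A k Y \<longleftrightarrow> closedin X Y \<and>
     (\<forall>p\<in>Y. \<exists>ch I. holomorphic_chart X A ch \<and> p \<in> fst ch \<and> card I = k \<and>
        snd ch ` (fst ch \<inter> Y) = {z \<in> snd ch ` fst ch. \<forall>i. i \<notin> I \<longrightarrow> z $ i = 0})"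

text \<open>In the next two definitions \<open>d\<close> has to be the complex, respectively real,
  codimension of \<open>Y\<close> in \<open>X\<close>.\<close>

definition holomorphic_complete_intersection ::
    "'a topology \<Rightarrow> ('a, complex^'n) chart set \<Rightarrow> nat \<Rightarrow> 'a set \<Rightarrow> bool" where
  "holomorphic_complete_intersection X A d Y \<longleftrightarrow>
     (\<exists>f. (\<forall>i<d. f i \<in> holomorphic_functions A) \<and>
          Y = {x \<in> topspace X. \<forall>i<d. f i x = 0} \<and>
          (\<forall>x\<in>Y. independent_differentials A d f x))"

definition differentiable_complete_intersection ::
    "'a topology \<Rightarrow> ('a, 'e::euclidean_space) chart set \<Rightarrow> nat \<Rightarrow> 'a set \<Rightarrow> bool" where
  "differentiable_complete_intersection X A d Y \<longleftrightarrow>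
     (\<exists>f. (\<forall>i<d. f i \<in> smooth_functions A) \<and>
          Y = {x \<in> topspace X. \<forall>i<d. f i x = 0} \<and>
          (\<forall>x\<in>Y. independent_differentials A d f x))"

end

theory Submission
  imports Defs "HOL-Complex_Analysis.Cauchy_Integral_Formula"
begin

text \<open>\<open>Y\<close> is the affine quadric of rank one projectors \<open>P\<close> of \<open>\<complex>\<^sup>2\<close>.  Sending \<open>P\<close> to its
  image is a bundle of affine lines over the projective line, so \<open>Y\<close> is homotopy equivalent to the
  two-sphere.  \<open>X\<close> is the total space of \<open>L \<oplus> \<complex>\<close> over \<open>Y\<close>, where \<open>L\<close> consists of the
  endomorphisms \<open>A\<close> that map to the image of \<open>P\<close> and vanish on it; it is closed in \<open>\<complex>\<^sup>9\<close>, hence Stein.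
  As a real bundle \<open>L\<close> is the pullback of the tangent bundle of the sphere, which becomes trivial
  after adding a trivial real line, and a trivialization of \<open>L \<oplus> \<complex>\<close> gives four real equations
  for \<open>Y\<close>.  Two holomorphic equations would instead trivialize the determinant \<open>L\<close> of the normal
  bundle as a complex line bundle, but the degree of \<open>L\<close> on the sphere is \<open>-2\<close>.\<close>

section \<open>The total space and its two charts\<close>

text \<open>Why degree -2 works: oriented real bundles of rank four over the sphere are classified
  by pi_1(SO(4)) = Z/2, and for the real bundle underlying a complex one this class is the parity of
  the degree. An even nonzero degree is therefore invisible to smooth equations but obstructs
  holomorphic ones. Here L = Hom(C^2 / im P, im P) is isomorphic to the tensor square of the
  tautological bundle im P. The trivialization is explicit. Write P^H for the conjugate transpose.
  The traceless Hermitian 2x2 matrices form a real 3-space; in it A + A^H is tangent to the sphere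
  of orthogonal rank one projectors, and the traceless part of P P^H is normal to that sphere. So A
  and Re t combine into one such matrix, and Im t is the fourth real coordinate. Independence of
  differentials is tested in every chart of the atlas. The construction is therefore built around
  the involution \<open>swap\<close>: the second chart is the first one composed with
  \<open>swap\<close>, and both have image C^4.\<close>

lemma exhaust_9:
  fixes i :: 9
  shows "i = 1 \<or> i = 2 \<or> i = 3 \<or> i = 4 \<or> i = 5 \<or> i = 6 \<or> i = 7 \<or> i = 8 \<or> i = 9"
proof (induct i)
  case (of_int z)
  then have "z = 0 \<or> z = 1 \<or> z = 2 \<or> z = 3 \<or> z = 4 \<or> z = 5 \<or> z = 6 \<or> z = 7 \<or> z = 8" by fastforce
  then show ?case by auto
qed

lemma forall_9:
  "(\<forall>i::9. P i) \<longleftrightarrow> P 1 \<and> P 2 \<and> P 3 \<and> P 4 \<and> P 5 \<and> P 6 \<and> P 7 \<and> P 8 \<and> P 9"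
  by (metis exhaust_9)

lemma vector_4 [simp]:
  "(vector [a,b,c,d] :: ('a::zero)^4)$1 = a"
  "(vector [a,b,c,d] :: ('a::zero)^4)$2 = b"
  "(vector [a,b,c,d] :: ('a::zero)^4)$3 = c"
  "(vector [a,b,c,d] :: ('a::zero)^4)$4 = d"
  unfolding vector_def by simp_all

lemma vector_9 [simp]:
  "(vector [a,b,c,d,e,f,g,h,k] :: ('a::zero)^9)$1 = a"
  "(vector [a,b,c,d,e,f,g,h,k] :: ('a::zero)^9)$2 = b"
  "(vector [a,b,c,d,e,f,g,h,k] :: ('a::zero)^9)$3 = c"
  "(vector [a,b,c,d,e,f,g,h,k] :: ('a::zero)^9)$4 = d"
  "(vector [a,b,c,d,e,f,g,h,k] :: ('a::zero)^9)$5 = e"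
  "(vector [a,b,c,d,e,f,g,h,k] :: ('a::zero)^9)$6 = f"
  "(vector [a,b,c,d,e,f,g,h,k] :: ('a::zero)^9)$7 = g"
  "(vector [a,b,c,d,e,f,g,h,k] :: ('a::zero)^9)$8 = h"
  "(vector [a,b,c,d,e,f,g,h,k] :: ('a::zero)^9)$9 = k"
  unfolding vector_def by simp_all

lemma vec_eq_4: "(x :: 'a^4) = y \<longleftrightarrow> x$1 = y$1 \<and> x$2 = y$2 \<and> x$3 = y$3 \<and> x$4 = y$4"
  by (simp add: vec_eq_iff forall_4)

lemma vec_eq_9:
  "(x :: 'a^9) = y \<longleftrightarrow> x$1 = y$1 \<and> x$2 = y$2 \<and> x$3 = y$3 \<and> x$4 = y$4 \<and> x$5 = y$5 \<and>
     x$6 = y$6 \<and> x$7 = y$7 \<and> x$8 = y$8 \<and> x$9 = y$9"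
  by (simp add: vec_eq_iff forall_9)

text \<open>A point of \<open>complex^9\<close> is read as \<open>(P, A, t)\<close> with the \<open>2 \<times> 2\<close> matrices
  \<open>P = [[x$1, x$2], [x$3, x$4]]\<close> and \<open>A = [[x$5, x$6], [x$7, x$8]]\<close>.  The equations say
  \<open>tr P = 1\<close>, \<open>det P = 0\<close>, \<open>P A = A\<close> and \<open>A P = 0\<close>.\<close>

definition total_space :: "(complex^9) set" where
  "total_space = {x. x$1 + x$4 = 1 \<and> x$1 * x$4 = x$2 * x$3 \<and>
     x$1 * x$5 + x$2 * x$7 = x$5 \<and> x$1 * x$6 + x$2 * x$8 = x$6 \<and>
     x$3 * x$5 + x$4 * x$7 = x$7 \<and> x$3 * x$6 + x$4 * x$8 = x$8 \<and>
     x$5 * x$1 + x$6 * x$3 = 0 \<and> x$5 * x$2 + x$6 * x$4 = 0 \<and>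
     x$7 * x$1 + x$8 * x$3 = 0 \<and> x$7 * x$2 + x$8 * x$4 = 0}"

definition zero_section :: "(complex^9) set" where
  "zero_section = {x \<in> total_space. x$5 = 0 \<and> x$6 = 0 \<and> x$7 = 0 \<and> x$8 = 0 \<and> x$9 = 0}"

text \<open>Conjugation of \<open>P\<close> and \<open>A\<close> by the transposition of the two basis vectors.\<close>

definition swap :: "complex^9 \<Rightarrow> complex^9" where
  "swap x = vector [x$4, x$3, x$2, x$1, x$8, x$7, x$6, x$5, x$9]"

definition patch :: "(complex^9) set" where
  "patch = {x \<in> total_space. x$1 \<noteq> 0 \<or> x$2 \<noteq> 0}"

text \<open>The coordinates \<open>(u, b, w, t)\<close> describe \<open>P\<close> as the column \<open>(1, u)\<close> times the row
  \<open>(1 - u b, b)\<close>, and \<open>A\<close> as \<open>w\<close> times the column \<open>(1, u)\<close> times the row \<open>(-u, 1)\<close>.\<close>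

definition param :: "complex^4 \<Rightarrow> complex^9" where
  "param z = vector [1 - z$1 * z$2, z$2, z$1 * (1 - z$1 * z$2), z$1 * z$2,
     - (z$1 * z$3), z$3, - (z$1 * z$1 * z$3), z$1 * z$3, z$4]"

text \<open>On \<open>patch\<close> the slope \<open>u\<close> equals \<open>x$3 / x$1\<close> or \<open>x$4 / x$2\<close>, whichever is defined.\<close>

definition coord :: "complex^9 \<Rightarrow> complex^4" where
  "coord x = vector [(x$3 * cnj (x$1) + x$4 * cnj (x$2)) / (x$1 * cnj (x$1) + x$2 * cnj (x$2)),
     x$2, x$6, x$9]"

text \<open>The change from \<open>chart0\<close> to \<open>chart1\<close>, meant for nonzero slope.
  Swapping turns the column (1, u) into u times (1, 1/u) and the row (-u, 1) into -u times (-1/u,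
  1), so the fiber coordinate w picks up the factor -u^2. This factor is the cocycle of L.\<close>

definition transition :: "complex^4 \<Rightarrow> complex^4" where
  "transition z = vector [1 / z$1, z$1 * (1 - z$1 * z$2), - (z$1 * z$1 * z$3), z$4]"

section \<open>Parametrization and coordinates as mutually inverse maps\<close>

lemma sum_norm_sq_nonzero:
  fixes a b :: complex
  assumes "a \<noteq> 0 \<or> b \<noteq> 0"
  shows "a * cnj a + b * cnj b \<noteq> 0"
proof -
  have "a * cnj a + b * cnj b = of_real ((norm a)\<^sup>2 + (norm b)\<^sup>2)"
    by (simp only: complex_norm_square of_real_add)
  moreover have "(norm a)\<^sup>2 + (norm b)\<^sup>2 \<noteq> 0"
    using assms by (simp add: sum_power2_eq_zero_iff)
  ultimately show ?thesis
    by (metis of_real_eq_0_iff)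
qed

text \<open>The Hermitian inner product with (a, b) extracts the factor c without deciding which of
  a, b is nonzero. This lets \<open>coord\<close> be one formula, evidently continuous on all of
  \<open>patch\<close>.\<close>

lemma slope_eq:
  fixes a b c :: complex
  assumes "a \<noteq> 0 \<or> b \<noteq> 0" "x = c * a" "y = c * b"
  shows "(x * cnj a + y * cnj b) / (a * cnj a + b * cnj b) = c"
  using sum_norm_sq_nonzero[OF assms(1)] assms(2,3) by (simp add: field_simps)

lemma param_in_patch [simp]: "param z \<in> patch"
  by (auto simp: patch_def total_space_def param_def algebra_simps)

lemma coord_param [simp]: "coord (param z) = z"
proof -
  have "(param z $ 3 * cnj (param z $ 1) + param z $ 4 * cnj (param z $ 2)) /
      (param z $ 1 * cnj (param z $ 1) + param z $ 2 * cnj (param z $ 2)) = z $ 1"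
    by (rule slope_eq) (auto simp: param_def)
  then show ?thesis
    unfolding coord_def by (simp add: vec_eq_4) (simp add: param_def)
qed

text \<open>Since det P = 0 and the first row of P is nonzero, the second row is u times the first.
  Then A P = 0 makes each row of A a multiple of (-u, 1), P A = A makes the second row of A equal to
  u times the first, and tr P = 1 gives the entry 1 - u b.\<close>

lemma param_coord:
  assumes "x \<in> patch"
  shows "param (coord x) = x"
proof -
  define a b c d p q r s where "a = x$1" "b = x$2" "c = x$3" "d = x$4" "p = x$5" "q = x$6" "r = x$7" "s = x$8"
  note defs = this
  have ab: "a \<noteq> 0 \<or> b \<noteq> 0" and eqs: "a + d = 1" "a * d = b * c"
      "a * p + b * r = p" "a * q + b * s = q" "c * p + d * r = r" "c * q + d * s = s"
      "p * a + q * c = 0" "p * b + q * d = 0"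
    using assms by (auto simp: patch_def total_space_def defs)
  obtain u where u: "c = u * a" "d = u * b"
  proof (cases "a = 0")
    case True
    then show ?thesis using that[of "d / b"] ab eqs(2) by auto
  next
    case False
    then show ?thesis using that[of "c / a"] eqs(2) by (auto simp: field_simps)
  qed
  have cu: "coord x $ 1 = u"
    unfolding coord_def using slope_eq[OF ab u] by (simp add: defs)
  have p: "p = - (u * q)"
  proof (cases "a = 0")
    case True
    then have "b * (p + u * q) = 0" "b \<noteq> 0" using eqs(8) u ab by (auto simp: algebra_simps)
    then show ?thesis by (simp add: add_eq_0_iff)
  next
    case False
    moreover have "a * (p + u * q) = 0" using eqs(7) u by (simp add: algebra_simps)
    ultimately show ?thesis by (simp add: add_eq_0_iff)
  qed
  \<comment> \<open>The second row of P A is u times its first row, which is the first row of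
    A.\<close>
  have r: "r = u * p"
    using eqs(5) unfolding u by (simp add: eqs(3) mult.assoc flip: distrib_left)
  have s: "s = u * q"
    using eqs(6) unfolding u by (simp add: eqs(4) mult.assoc flip: distrib_left)
  have "param (coord x) $ k = x $ k" for k
  proof -
    have c': "coord x $ 2 = b" "coord x $ 3 = q" "coord x $ 4 = x $ 9"
      by (simp_all add: coord_def defs)
    have a: "1 - u * b = a" using eqs(1) u by (simp add: algebra_simps)
    show ?thesis
      using exhaust_9[of k] cu c' a u p r s by (auto simp: param_def simp flip: defs)
  qed
  then show ?thesis by (simp add: vec_eq_iff)
qed

lemma swap_swap [simp]: "swap (swap x) = x"
  by (simp add: swap_def vec_eq_9)

lemma swap_comp_swap [simp]: "swap \<circ> swap = id"
  by (simp add: fun_eq_iff)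

lemma swap_in_total_space [simp]: "swap x \<in> total_space \<longleftrightarrow> x \<in> total_space"
  by (auto simp: swap_def total_space_def algebra_simps)

lemma swap_in_zero_section [simp]: "swap x \<in> zero_section \<longleftrightarrow> x \<in> zero_section"
  by (auto simp: zero_section_def) (auto simp: swap_def)

lemma patch_subset: "patch \<subseteq> total_space"
  by (auto simp: patch_def)

lemma param_in_total_space [simp]: "param z \<in> total_space"
  using param_in_patch patch_subset by blast

lemma in_patch_or_swap_in_patch:
  assumes "x \<in> total_space"
  shows "x \<in> patch \<or> swap x \<in> patch"
  using assms by (auto simp: patch_def) (auto simp: swap_def total_space_def)

lemma swap_param_in_patch: "swap (param z) \<in> patch \<longleftrightarrow> z$1 \<noteq> 0"
  by (auto simp: patch_def) (auto simp: swap_def param_def)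

lemma coord_swap_param:
  assumes "z$1 \<noteq> 0"
  shows "coord (swap (param z)) = transition z"
proof -
  let ?x = "swap (param z)"
  have "(?x $ 3 * cnj (?x $ 1) + ?x $ 4 * cnj (?x $ 2)) /
      (?x $ 1 * cnj (?x $ 1) + ?x $ 2 * cnj (?x $ 2)) = 1 / z$1"
    by (rule slope_eq) (use assms in \<open>auto simp: param_def swap_def field_simps\<close>)
  then show ?thesis
    unfolding coord_def by (simp add: vec_eq_4 transition_def) (simp add: param_def swap_def)
qed

lemma swap_param_eq: "z$1 \<noteq> 0 \<Longrightarrow> swap (param z) = param (transition z)"
  by (metis coord_swap_param param_coord swap_param_in_patch)

lemma param_in_zero_section: "param z \<in> zero_section \<longleftrightarrow> z$3 = 0 \<and> z$4 = 0"
  by (auto simp: zero_section_def) (auto simp: param_def)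

lemma continuous_on_vec:
  assumes "\<And>i. continuous_on S (\<lambda>x. f x $ i)"
  shows "continuous_on S f"
  using continuous_on_vec_lambda[of S "\<lambda>i x. f x $ i"] assms by simp

lemma continuous_on_swap: "continuous_on S swap"
proof (rule continuous_on_vec)
  show "continuous_on S (\<lambda>x. swap x $ i)" for i
    using exhaust_9[of i] by (elim disjE; simp add: swap_def; intro continuous_intros)
qed

lemma continuous_on_param: "continuous_on S param"
proof (rule continuous_on_vec)
  show "continuous_on S (\<lambda>x. param x $ i)" for i
    using exhaust_9[of i] by (elim disjE; simp add: param_def; intro continuous_intros)
qed

lemma continuous_on_coord: "continuous_on patch coord"
proof (rule continuous_on_vec)
  show "continuous_on patch (\<lambda>x. coord x $ i)" for i
    using exhaust_4[of i]
    by (elim disjE; simp add: coord_def; intro continuous_intros)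
      (auto simp: patch_def sum_norm_sq_nonzero)
qed

lemma closed_total_space: "closed total_space"
  unfolding total_space_def
  by (intro closed_Collect_conj closed_Collect_eq continuous_intros)

lemma mem_swap_image: "x \<in> swap ` S \<longleftrightarrow> swap x \<in> S"
  by (metis image_iff swap_swap)

lemma openin_patch: "openin (top_of_set total_space) patch"
proof -
  have op: "open {x :: complex^9. x$1 \<noteq> 0 \<or> x$2 \<noteq> 0}"
    by (intro open_Collect_disj open_Collect_neq continuous_intros)
  have eq: "patch = total_space \<inter> {x. x$1 \<noteq> 0 \<or> x$2 \<noteq> 0}"
    by (auto simp: patch_def)
  show ?thesis
    unfolding eq by (rule openin_open_Int[OF op])
qed

lemma openin_swap_patch: "openin (top_of_set total_space) (swap ` patch)"
proof -
  have op: "open {x :: complex^9. x$4 \<noteq> 0 \<or> x$3 \<noteq> 0}"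
    by (intro open_Collect_disj open_Collect_neq continuous_intros)
  have eq: "swap ` patch = total_space \<inter> {x. x$4 \<noteq> 0 \<or> x$3 \<noteq> 0}"
    by (auto simp: mem_swap_image patch_def) (auto simp: swap_def)
  show ?thesis
    unfolding eq by (rule openin_open_Int[OF op])
qed

section \<open>Holomorphic functions\<close>

lemma holomorphic_fun_on_const: "open U \<Longrightarrow> holomorphic_fun_on (\<lambda>z. c) U"
  unfolding holomorphic_fun_on_def by (auto intro!: exI[of _ "\<lambda>v. 0"])

lemma holomorphic_fun_on_nth: "open U \<Longrightarrow> holomorphic_fun_on (\<lambda>z. z $ i) U"
  unfolding holomorphic_fun_on_def
  by (auto intro!: exI[of _ "\<lambda>v. v $ i"] bounded_linear_imp_has_derivative bounded_linear_vec_nth)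

lemma holomorphic_fun_on_add:
  assumes "holomorphic_fun_on f U" "holomorphic_fun_on g U"
  shows "holomorphic_fun_on (\<lambda>z. f z + g z) U"
  unfolding holomorphic_fun_on_def
proof safe
  show "open U" using assms by (simp add: holomorphic_fun_on_def)
  fix z assume "z \<in> U"
  then obtain D E where "(f has_derivative D) (at z)" "(g has_derivative E) (at z)"
    and "\<And>c v. D (c *s v) = c * D v" "\<And>c v. E (c *s v) = c * E v"
    using assms by (meson holomorphic_fun_on_def)
  then show "\<exists>D. ((\<lambda>z. f z + g z) has_derivative D) (at z) \<and> (\<forall>c v. D (c *s v) = c * D v)"
    by (intro exI[of _ "\<lambda>v. D v + E v"]) (auto intro: has_derivative_add simp: algebra_simps)
qed

lemma holomorphic_fun_on_mult:
  assumes "holomorphic_fun_on f U" "holomorphic_fun_on g U"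
  shows "holomorphic_fun_on (\<lambda>z. f z * g z) U"
  unfolding holomorphic_fun_on_def
proof safe
  show "open U" using assms by (simp add: holomorphic_fun_on_def)
  fix z assume "z \<in> U"
  then obtain D E where "(f has_derivative D) (at z)" "(g has_derivative E) (at z)"
    and "\<And>c v. D (c *s v) = c * D v" "\<And>c v. E (c *s v) = c * E v"
    using assms by (meson holomorphic_fun_on_def)
  then show "\<exists>D. ((\<lambda>z. f z * g z) has_derivative D) (at z) \<and> (\<forall>c v. D (c *s v) = c * D v)"
    by (intro exI[of _ "\<lambda>v. f z * E v + D v * g z"] conjI has_derivative_mult)
      (simp_all add: algebra_simps)
qed

lemma holomorphic_fun_on_uminus:
  "holomorphic_fun_on f U \<Longrightarrow> holomorphic_fun_on (\<lambda>z. - f z) U"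
  using holomorphic_fun_on_mult[OF holomorphic_fun_on_const[of U "-1"]]
  by (auto simp: holomorphic_fun_on_def)

lemma holomorphic_fun_on_diff:
  "holomorphic_fun_on f U \<Longrightarrow> holomorphic_fun_on g U \<Longrightarrow> holomorphic_fun_on (\<lambda>z. f z - g z) U"
  using holomorphic_fun_on_add[OF _ holomorphic_fun_on_uminus] by auto

lemma holomorphic_fun_on_inverse:
  assumes "holomorphic_fun_on f U" "\<And>z. z \<in> U \<Longrightarrow> f z \<noteq> 0"
  shows "holomorphic_fun_on (\<lambda>z. 1 / f z) U"
  unfolding holomorphic_fun_on_def
proof safe
  show "open U" using assms by (simp add: holomorphic_fun_on_def)
  fix z assume "z \<in> U"
  then obtain D where "(f has_derivative D) (at z)" "\<And>c v. D (c *s v) = c * D v"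
    using assms by (meson holomorphic_fun_on_def)
  with assms(2)[OF \<open>z \<in> U\<close>]
  show "\<exists>D. ((\<lambda>z. 1 / f z) has_derivative D) (at z) \<and> (\<forall>c v. D (c *s v) = c * D v)"
    unfolding inverse_eq_divide[symmetric]
    by (intro exI[of _ "\<lambda>v. - (inverse (f z) * D v * inverse (f z))"])
      (auto intro!: has_derivative_inverse)
qed

lemmas holomorphic_fun_on_intros =
  holomorphic_fun_on_const holomorphic_fun_on_nth holomorphic_fun_on_add holomorphic_fun_on_mult
  holomorphic_fun_on_uminus holomorphic_fun_on_diff holomorphic_fun_on_inverse

lemma holomorphic_fun_on_cong:
  assumes "holomorphic_fun_on f U" "\<And>z. z \<in> U \<Longrightarrow> f z = g z"
  shows "holomorphic_fun_on g U"
  using assms unfolding holomorphic_fun_on_def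
  by (meson has_derivative_transform_within_open)

lemma holomorphic_fun_on_imp_differentiable:
  "holomorphic_fun_on f U \<Longrightarrow> z \<in> U \<Longrightarrow> f differentiable (at z)"
  unfolding holomorphic_fun_on_def differentiable_def by blast

lemma holomorphic_fun_on_imp_continuous_on:
  "holomorphic_fun_on f U \<Longrightarrow> continuous_on U f"
  by (meson continuous_at_imp_continuous_on differentiable_imp_continuous_within
      holomorphic_fun_on_imp_differentiable)

section \<open>The complex manifold\<close>

abbreviation chart0 :: "(complex^9, complex^4) chart" where
  "chart0 \<equiv> (patch, coord)"

abbreviation chart1 :: "(complex^9, complex^4) chart" where
  "chart1 \<equiv> (swap ` patch, coord \<circ> swap)"

definition atlas :: "(complex^9, complex^4) chart set" where
  "atlas = {chart0, chart1}"

lemma inj_on_coord: "inj_on coord patch"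
  by (metis inj_onI param_coord)

lemma inj_on_coord_swap: "inj_on (coord \<circ> swap) (swap ` patch)"
  using inj_on_coord by (auto simp: inj_on_def)

text \<open>The equality holds on all of C^4, because \<open>coord\<close> maps \<open>patch\<close>
  onto it. Functions on X are thus read in each chart as functions on \<open>UNIV\<close>.\<close>

lemma in_chart0: "in_chart chart0 f = f \<circ> param"
proof -
  have "inv_into patch coord = param"
    using inv_into_f_eq[OF inj_on_coord] by (auto simp: fun_eq_iff)
  then show ?thesis by (simp add: in_chart_def)
qed

lemma in_chart1: "in_chart chart1 f = f \<circ> swap \<circ> param"
proof -
  have "inv_into (swap ` patch) (coord \<circ> swap) = swap \<circ> param"
    using inv_into_f_eq[OF inj_on_coord_swap] by (auto simp: fun_eq_iff)
  then show ?thesis by (simp add: in_chart_def comp_assoc)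
qed

lemma coord_image: "coord ` patch = UNIV"
proof -
  have "z \<in> coord ` patch" for z
    using image_eqI[of z coord "param z" patch] by simp
  then show ?thesis by blast
qed

lemma coord_swap_image: "(coord \<circ> swap) ` swap ` patch = UNIV"
  by (simp add: image_comp comp_assoc coord_image)

lemma topological_chart0: "topological_chart (top_of_set total_space) chart0"
proof -
  have "homeomorphic_maps (top_of_set patch) euclidean coord param"
    by (auto simp: homeomorphic_maps_def param_coord continuous_on_coord continuous_on_param
        continuous_map_in_subtopology)
  then show ?thesis
    using patch_subset
    by (auto simp: topological_chart_def openin_patch coord_image subtopology_subtopology
        Int_absorb1 homeomorphic_map_maps)
qed

lemma topological_chart1: "topological_chart (top_of_set total_space) chart1"
proof -
  have "continuous_on (swap ` patch) (coord \<circ> swap)"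
    by (intro continuous_on_compose continuous_on_swap) (simp add: image_comp continuous_on_coord)
  moreover have "continuous_on UNIV (swap \<circ> param)"
    by (intro continuous_on_compose continuous_on_swap continuous_on_param)
  ultimately have "homeomorphic_maps (top_of_set (swap ` patch)) euclidean (coord \<circ> swap) (swap \<circ> param)"
    by (auto simp: homeomorphic_maps_def param_coord continuous_map_in_subtopology o_def)
  moreover have "swap ` patch \<subseteq> total_space"
    using patch_subset by auto
  ultimately show ?thesis
    unfolding topological_chart_def fst_conv snd_conv coord_swap_image
    by (auto simp: openin_swap_patch subtopology_subtopology Int_absorb1 homeomorphic_map_maps)
qed

lemma coord_image_overlap: "coord ` (patch \<inter> swap ` patch) = {z. z$1 \<noteq> 0}"
proof
  show "coord ` (patch \<inter> swap ` patch) \<subseteq> {z. z$1 \<noteq> 0}"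
    by (auto simp: mem_swap_image) (metis param_coord swap_param_in_patch swap_swap)
  show "{z. z$1 \<noteq> 0} \<subseteq> coord ` (patch \<inter> swap ` patch)"
  proof
    fix z :: "complex^4" assume "z \<in> {z. z$1 \<noteq> 0}"
    then have "param z \<in> patch \<inter> swap ` patch"
      by (simp add: mem_swap_image swap_param_in_patch)
    then show "z \<in> coord ` (patch \<inter> swap ` patch)"
      by (metis coord_param image_eqI)
  qed
qed

lemma coord_swap_image_overlap: "(coord \<circ> swap) ` (swap ` patch \<inter> patch) = {z. z$1 \<noteq> 0}"
proof -
  have "swap ` (swap ` patch \<inter> patch) = patch \<inter> swap ` patch"
    by (auto simp: mem_swap_image)
  then show ?thesis
    by (metis coord_image_overlap image_comp)
qed

lemma open_nonzero_nth: "open {z :: complex^'n. z $ i \<noteq> 0}"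
  by (intro open_Collect_neq continuous_intros)

lemma holomorphic_transition_atlas:
  assumes "c1 \<in> atlas" "c2 \<in> atlas"
  shows "holomorphic_transition c1 c2"
proof -
  have trans: "holomorphic_fun_on (\<lambda>z. coord (swap (param z)) $ i) {z. z$1 \<noteq> 0}" for i
  proof (rule holomorphic_fun_on_cong)
    show "holomorphic_fun_on (\<lambda>z. transition z $ i) {z. z$1 \<noteq> 0}"
      using exhaust_4[of i]
      by (elim disjE; simp add: transition_def; intro holomorphic_fun_on_intros open_nonzero_nth)
        auto
  qed (simp add: coord_swap_param)
  have "holomorphic_transition chart0 chart0" "holomorphic_transition chart1 chart1"
    unfolding holomorphic_transition_def holomorphic_map_on_def in_chart0 in_chart1 fst_conv snd_conv
      Int_absorb coord_image coord_swap_image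
    by (auto intro: holomorphic_fun_on_nth)
  moreover have "holomorphic_transition chart0 chart1" "holomorphic_transition chart1 chart0"
    unfolding holomorphic_transition_def holomorphic_map_on_def in_chart0 in_chart1 fst_conv snd_conv
      coord_image_overlap coord_swap_image_overlap
    using trans by auto
  ultimately show ?thesis using assms by (auto simp: atlas_def)
qed

lemma second_countable_top_of_set:
  "second_countable_topology_space (top_of_set (S :: 'a::second_countable_topology set))"
proof -
  obtain B :: "'a set set" where B: "countable B" "topological_basis B"
    using ex_countable_basis by blast
  show ?thesis
    unfolding second_countable_topology_space_def
  proof (intro exI[of _ "(\<inter>) S ` B"] conjI ballI allI impI)
    show "countable ((\<inter>) S ` B)" using B by simp
    show "openin (top_of_set S) V" if "V \<in> (\<inter>) S ` B" for V
      using that topological_basis_open[OF B(2)] openin_open_Int by blast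
    show "\<exists>V\<in>(\<inter>) S ` B. x \<in> V \<and> V \<subseteq> U" if U: "openin (top_of_set S) U \<and> x \<in> U" for U x
    proof -
      obtain W where W: "open W" "U = S \<inter> W" using U by (auto simp: openin_open)
      then have "x \<in> W" using U by simp
      then obtain V where "V \<in> B" "x \<in> V" "V \<subseteq> W"
        by (rule topological_basisE[OF B(2) W(1)])
      then show ?thesis using W U by (intro bexI[of _ "S \<inter> V"]) auto
    qed
  qed
qed

lemma complex_manifold_total_space: "complex_manifold (top_of_set total_space) atlas"
  unfolding complex_manifold_def
proof (intro conjI ballI)
  show "Hausdorff_space (top_of_set total_space)"
    by (simp add: Hausdorff_space_subtopology)
  show "topological_chart (top_of_set total_space) ch" if "ch \<in> atlas" for ch
    using that topological_chart0 topological_chart1 by (auto simp: atlas_def)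
  show "\<Union> (fst ` atlas) = topspace (top_of_set total_space)"
    by (auto simp: atlas_def mem_swap_image dest: in_patch_or_swap_in_patch subsetD[OF patch_subset])
qed (use second_countable_top_of_set holomorphic_transition_atlas in auto)

lemma closed_complex_submanifold_zero_section:
  "closed_complex_submanifold (top_of_set total_space) atlas 2 zero_section"
  unfolding closed_complex_submanifold_def
proof (intro conjI ballI)
  have "closed zero_section"
    unfolding zero_section_def
    by (intro closed_Collect_conj closed_Collect_eq continuous_intros)
      (simp add: closed_total_space)
  then show "closedin (top_of_set total_space) zero_section"
    by (auto simp: closedin_closed_eq closed_total_space zero_section_def)
next
  fix p assume p: "p \<in> zero_section"
  have hol: "holomorphic_chart (top_of_set total_space) atlas ch" if "ch \<in> atlas" for ch
    using that complex_manifold_total_space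
    by (auto simp: holomorphic_chart_def complex_manifold_def)
  \<comment> \<open>The slope u and the entry b are the free coordinates along Y; w and t are the
    fiber coordinates.\<close>
  have I: "(\<forall>i. i \<notin> {1, 2} \<longrightarrow> z $ i = 0) \<longleftrightarrow> z$3 = 0 \<and> z$4 = 0" for z :: "complex^4"
    by (simp add: forall_4)
  have im0: "coord ` (patch \<inter> zero_section) = {z. z$3 = 0 \<and> z$4 = 0}"
  proof -
    have "coord ` (patch \<inter> zero_section) = {z. param z \<in> zero_section}"
      by (auto simp: param_coord) (metis IntI coord_param image_eqI param_in_patch)
    then show ?thesis by (simp add: param_in_zero_section)
  qed
  have im1: "(coord \<circ> swap) ` (swap ` patch \<inter> zero_section) = {z. z$3 = 0 \<and> z$4 = 0}"
  proof -
    have "swap ` (swap ` patch \<inter> zero_section) = patch \<inter> zero_section"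
      by (auto simp: mem_swap_image)
    then show ?thesis by (metis im0 image_comp)
  qed
  obtain ch where ch: "ch \<in> atlas" "p \<in> fst ch"
    using p in_patch_or_swap_in_patch[of p] that[of chart0] that[of chart1]
    by (auto simp: atlas_def zero_section_def mem_swap_image)
  have "card {1, 2 :: 4} = 2" by simp
  moreover have "snd ch ` (fst ch \<inter> zero_section) =
      {z \<in> snd ch ` fst ch. \<forall>i. i \<notin> {1, 2} \<longrightarrow> z $ i = 0}"
    unfolding I using ch(1) im0 im1 coord_image coord_swap_image by (auto simp: atlas_def)
  ultimately show "\<exists>ch I. holomorphic_chart (top_of_set total_space) atlas ch \<and> p \<in> fst ch \<and>
      card I = 2 \<and> snd ch ` (fst ch \<inter> zero_section) =
        {z \<in> snd ch ` fst ch. \<forall>i. i \<notin> I \<longrightarrow> z $ i = 0}"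
    using hol ch by blast
qed

section \<open>Global holomorphic functions and holomorphic convexity\<close>

lemma holomorphic_functions_iff:
  "f \<in> holomorphic_functions atlas \<longleftrightarrow>
     holomorphic_fun_on (f \<circ> param) UNIV \<and> holomorphic_fun_on (f \<circ> swap \<circ> param) UNIV"
  unfolding holomorphic_functions_def atlas_def
  by (simp add: in_chart0 in_chart1 coord_image coord_swap_image[simplified])

lemma holomorphic_functions_nth: "(\<lambda>x. x $ i) \<in> holomorphic_functions atlas"
  unfolding holomorphic_functions_iff o_def using exhaust_9[of i]
  by (elim disjE; simp add: param_def swap_def; intro conjI holomorphic_fun_on_intros open_UNIV)

lemma holomorphic_functions_add_mult:
  assumes "f \<in> holomorphic_functions atlas" "g \<in> holomorphic_functions atlas"
  shows "(\<lambda>x. f x + c * g x) \<in> holomorphic_functions atlas"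
  using assms unfolding holomorphic_functions_iff o_def
  by (auto intro!: holomorphic_fun_on_intros)

lemma holomorphic_functions_swap:
  "f \<in> holomorphic_functions atlas \<Longrightarrow> f \<circ> swap \<in> holomorphic_functions atlas"
  by (simp add: holomorphic_functions_iff comp_assoc)

lemma total_space_eq: "total_space = patch \<union> swap ` patch"
  using complex_manifold_total_space by (simp add: complex_manifold_def atlas_def)

lemma holomorphic_functions_continuous_on:
  assumes "f \<in> holomorphic_functions atlas"
  shows "continuous_on total_space f"
proof -
  have *: "continuous_on patch g" if "holomorphic_fun_on (g \<circ> param) UNIV" for g :: "complex^9 \<Rightarrow> complex"
  proof -
    have "continuous_on patch ((g \<circ> param) \<circ> coord)"
      using holomorphic_fun_on_imp_continuous_on[OF that] continuous_on_coord
      by (meson continuous_on_compose continuous_on_subset subset_UNIV)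
    then show ?thesis
      by (rule continuous_on_eq) (simp add: param_coord)
  qed
  have "continuous_on patch f" "continuous_on patch (f \<circ> swap)"
    using assms * unfolding holomorphic_functions_iff by blast+
  moreover have "continuous_on (swap ` patch) f"
  proof -
    have "continuous_on (swap ` patch) ((f \<circ> swap) \<circ> swap)"
      using \<open>continuous_on patch (f \<circ> swap)\<close>
        continuous_on_compose[OF continuous_on_swap, of "swap ` patch" "f \<circ> swap"]
      by (simp add: image_comp)
    then show ?thesis by (rule continuous_on_eq) simp
  qed
  ultimately show ?thesis
    using continuous_on_Un_local_open[of patch "swap ` patch" f] openin_patch openin_swap_patch
    by (simp add: total_space_eq)
qed

text \<open>The nine coordinate functions are holomorphic, so any bound on K passes to the hull. The
  hull is also closed in C^9, being cut out of the closed set \<open>total_space\<close> by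
  inequalities between continuous functions.\<close>

lemma compactin_holomorphic_hull:
  assumes "compactin (top_of_set total_space) K"
  shows "compactin (top_of_set total_space) (holomorphic_hull (top_of_set total_space) atlas K)"
proof -
  let ?H = "holomorphic_hull (top_of_set total_space) atlas K"
  have K: "compact K" "K \<subseteq> total_space"
    using assms by (auto simp: compactin_subtopology)
  obtain B where B: "\<And>x. x \<in> K \<Longrightarrow> norm x \<le> B"
    using compact_imp_bounded[OF K(1)] by (auto simp: bounded_iff)
  have "?H = total_space \<inter>
      (\<Inter>f\<in>holomorphic_functions atlas. \<Inter>r\<in>{r. \<forall>y\<in>K. norm (f y) \<le> r}.
         {x \<in> total_space. norm (f x) \<le> r})"
    by (auto simp: holomorphic_hull_def)
  moreover have "closed {x \<in> total_space. norm (f x) \<le> r}"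
    if "f \<in> holomorphic_functions atlas" for f r
    using closed_total_space holomorphic_functions_continuous_on[OF that]
    by (intro continuous_on_closed_Collect_le continuous_on_norm continuous_on_const)
  ultimately have "closed ?H"
    by (simp add: closed_total_space closed_Int closed_INT)
  moreover have "bounded ?H"
    unfolding bounded_iff
  proof (intro exI ballI)
    fix x assume "x \<in> ?H"
    then have hull: "\<forall>f\<in>holomorphic_functions atlas. \<forall>r. (\<forall>y\<in>K. norm (f y) \<le> r) \<longrightarrow> norm (f x) \<le> r"
      by (simp add: holomorphic_hull_def)
    have "norm (x $ i) \<le> B" for i
    proof -
      have "\<forall>y\<in>K. norm (y $ i) \<le> B"
        using order_trans[OF Finite_Cartesian_Product.norm_nth_le B] by simp
      then show ?thesis
        using bspec[OF hull holomorphic_functions_nth[of i]] by simp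
    qed
    then have "(\<Sum>i\<in>UNIV. norm (x $ i)) \<le> of_nat (card (UNIV :: 9 set)) * B"
      by (intro sum_bounded_above)
    then show "norm x \<le> of_nat (card (UNIV :: 9 set)) * B"
      unfolding norm_vec_def using L2_set_le_sum[of UNIV "\<lambda>i. norm (x $ i)"] by simp
  qed
  ultimately have "compact ?H"
    by (simp add: compact_eq_bounded_closed)
  then show ?thesis
    by (auto simp: compactin_subtopology holomorphic_hull_def)
qed

text \<open>The condition in a single chart. It is polymorphic in the scalars so as to serve both
  the complex equations and the real ones.\<close>

definition independent_at ::
    "nat \<Rightarrow> (nat \<Rightarrow> complex^4 \<Rightarrow> 'k::real_normed_field) \<Rightarrow> complex^4 \<Rightarrow> bool" where
  "independent_at d F z \<longleftrightarrow>
     (\<forall>c. (\<forall>v. (\<Sum>i<d. c i * frechet_derivative (F i) (at z) v) = 0) \<longrightarrow> (\<forall>i<d. c i = 0))"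

lemma independent_differentials_iff:
  "independent_differentials atlas d f x \<longleftrightarrow>
     (x \<in> patch \<longrightarrow> independent_at d (\<lambda>i. f i \<circ> param) (coord x)) \<and>
     (swap x \<in> patch \<longrightarrow> independent_at d (\<lambda>i. f i \<circ> swap \<circ> param) (coord (swap x)))"
  unfolding independent_differentials_def independent_at_def differential_def atlas_def
  by (simp add: in_chart0 in_chart1 mem_swap_image)

lemma has_derivative_vec:
  fixes f :: "'a::real_normed_vector \<Rightarrow> 'b::euclidean_space^'n"
  assumes "\<And>i. ((\<lambda>x. f x $ i) has_derivative (\<lambda>v. f' v $ i)) (at x within S)"
  shows "(f has_derivative f') (at x within S)"
proof (rule has_derivative_componentwise_within[THEN iffD2], rule ballI)
  fix b :: "'b^'n" assume "b \<in> Basis"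
  then obtain i u where "b = axis i u" by (auto simp: Basis_vec_def)
  then show "((\<lambda>x. f x \<bullet> b) has_derivative (\<lambda>v. f' v \<bullet> b)) (at x within S)"
    using has_derivative_inner_left[OF assms[of i], of u] by (simp add: inner_axis)
qed

definition transition_deriv :: "complex^4 \<Rightarrow> complex^4 \<Rightarrow> complex^4" where
  "transition_deriv z v = vector [- (v$1 / (z$1 * z$1)),
     v$1 * (1 - 2 * z$1 * z$2) - z$1 * z$1 * v$2,
     - (2 * z$1 * z$3 * v$1) - z$1 * z$1 * v$3, v$4]"

lemma has_derivative_nth: "((\<lambda>z. z $ i) has_derivative (\<lambda>v. v $ i)) F"
  by (intro bounded_linear_imp_has_derivative bounded_linear_vec_nth)

lemma has_derivative_transition:
  assumes "z$1 \<noteq> 0"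
  shows "(transition has_derivative transition_deriv z) (at z)"
proof (rule has_derivative_vec)
  show "((\<lambda>x. transition x $ i) has_derivative (\<lambda>v. transition_deriv z v $ i)) (at z)" for i
    using exhaust_4[of i]
    by (elim disjE; simp add: transition_def transition_deriv_def)
      (use assms in \<open>auto intro!: derivative_eq_intros has_derivative_nth simp: field_simps\<close>)
qed

text \<open>Chain rule: since \<open>swap\<close> is an involution, the two chart expressions of f
  differ by \<open>transition\<close> on the open set of nonzero slopes.\<close>

lemma frechet_derivative_chart_change:
  assumes "(f \<circ> swap \<circ> param) differentiable (at (transition z))" "z$1 \<noteq> 0"
  shows "frechet_derivative (f \<circ> param) (at z) v =
    frechet_derivative (f \<circ> swap \<circ> param) (at (transition z)) (transition_deriv z v)"
proof -
  have "(f \<circ> swap \<circ> param \<circ> transition has_derivative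
      frechet_derivative (f \<circ> swap \<circ> param) (at (transition z)) \<circ> transition_deriv z) (at z)"
    by (rule diff_chain_at[OF has_derivative_transition[OF assms(2)]
          assms(1)[unfolded frechet_derivative_works]])
  then have "(f \<circ> param has_derivative
      frechet_derivative (f \<circ> swap \<circ> param) (at (transition z)) \<circ> transition_deriv z) (at z)"
    by (rule has_derivative_transform_within_open[OF _ open_nonzero_nth])
      (use assms(2) in \<open>auto simp flip: swap_param_eq\<close>)
  then show ?thesis
    by (simp add: frechet_derivative_at[symmetric])
qed

text \<open>A linear relation at \<open>transition z\<close>, evaluated on the vectors
  \<open>transition_deriv z v\<close>, is a relation at z with the same coefficients.\<close>

lemma independent_at_chart_change:
  assumes "\<And>i. i < d \<Longrightarrow> f i \<in> holomorphic_functions atlas" "z$1 \<noteq> 0"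
    and "independent_at d (\<lambda>i. f i \<circ> param) z"
  shows "independent_at d (\<lambda>i. f i \<circ> swap \<circ> param) (transition z)"
  unfolding independent_at_def
proof (rule allI, rule impI)
  fix c :: "nat \<Rightarrow> complex"
  assume *: "\<forall>v. (\<Sum>i<d. c i * frechet_derivative (f i \<circ> swap \<circ> param) (at (transition z)) v) = 0"
  have "(\<Sum>i<d. c i * frechet_derivative (f i \<circ> param) (at z) v) = 0" for v
  proof -
    have "(\<Sum>i<d. c i * frechet_derivative (f i \<circ> param) (at z) v) =
      (\<Sum>i<d. c i * frechet_derivative (f i \<circ> swap \<circ> param) (at (transition z)) (transition_deriv z v))"
      by (intro sum.cong refl arg_cong2[where f = "(*)"] frechet_derivative_chart_change
          holomorphic_fun_on_imp_differentiable[OF _ UNIV_I])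
        (use assms(1,2) in \<open>auto simp: holomorphic_functions_iff\<close>)
    then show ?thesis using * by simp
  qed
  then show "\<forall>i<d. c i = 0"
    using assms(3) unfolding independent_at_def by blast
qed

lemma sum_lessThan_4: "(\<Sum>i<(4::nat). f i) = f 0 + f 1 + f 2 + f 3"
  by (simp add: eval_nat_numeral)

lemma all_less_4: "(\<forall>i<(4::nat). P i) \<longleftrightarrow> P 0 \<and> P 1 \<and> P 2 \<and> P 3"
  by (auto simp: eval_nat_numeral less_Suc_eq)

lemma local_coordinates_patch:
  assumes "x \<in> patch"
  shows "\<exists>f. (\<forall>i<4. f i \<in> holomorphic_functions atlas) \<and> independent_differentials atlas 4 f x"
proof (intro exI conjI)
  define z where "z = coord x"
  \<comment> \<open>In coordinates x$3 = u - u^2 b and x$4 = u b. The differential of x$3 alone has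
    du-coefficient 1 - 2 u b, which may vanish; adding 2 u x$4 with u frozen at the given point
    makes this coefficient 1 there.\<close>
  define f :: "nat \<Rightarrow> complex^9 \<Rightarrow> complex" where
    "f i = [\<lambda>x. x$3 + (2 * z$1) * x$4, \<lambda>x. x$2, \<lambda>x. x$6, \<lambda>x. x$9] ! i" for i
  show hol: "\<forall>i<4. f i \<in> holomorphic_functions atlas"
    unfolding all_less_4
    by (simp add: f_def holomorphic_functions_add_mult holomorphic_functions_nth)
  have D0: "(f 0 \<circ> param has_derivative (\<lambda>v. v$1 + z$1 * z$1 * v$2)) (at z)"
    unfolding o_def f_def
    by (auto simp: param_def algebra_simps intro!: derivative_eq_intros has_derivative_nth)
  have D: "(f 1 \<circ> param has_derivative (\<lambda>v. v$2)) (at z)"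
     "(f 2 \<circ> param has_derivative (\<lambda>v. v$3)) (at z)"
     "(f 3 \<circ> param has_derivative (\<lambda>v. v$4)) (at z)"
    unfolding o_def f_def by (auto simp: param_def intro!: has_derivative_nth)
  note fd = frechet_derivative_at[OF D0, symmetric] frechet_derivative_at[OF D(1), symmetric]
    frechet_derivative_at[OF D(2), symmetric] frechet_derivative_at[OF D(3), symmetric]
  have ind: "independent_at 4 (\<lambda>i. f i \<circ> param) z"
    unfolding independent_at_def sum_lessThan_4 all_less_4 fd
  proof (intro allI impI)
    fix c :: "nat \<Rightarrow> complex"
    assume *: "\<forall>v::complex^4. c 0 * (v$1 + z$1 * z$1 * v$2) + c 1 * v$2 + c 2 * v$3 + c 3 * v$4 = 0"
    have "c 0 = 0" using spec[OF *, of "vector [1,0,0,0]"] by simp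
    then show "c 0 = 0 \<and> c 1 = 0 \<and> c 2 = 0 \<and> c 3 = 0"
      using spec[OF *, of "vector [0,1,0,0]"] spec[OF *, of "vector [0,0,1,0]"]
        spec[OF *, of "vector [0,0,0,1]"] by simp
  qed
  have "independent_at 4 (\<lambda>i. f i \<circ> swap \<circ> param) (coord (swap x))" if "swap x \<in> patch"
  proof -
    have "z$1 \<noteq> 0"
      using that assms by (metis z_def param_coord swap_param_in_patch)
    moreover have "coord (swap x) = transition z"
      using \<open>z$1 \<noteq> 0\<close> assms by (metis z_def param_coord coord_swap_param)
    ultimately show ?thesis
      using independent_at_chart_change[OF _ _ ind] hol by simp
  qed
  then show "independent_differentials atlas 4 f x"
    using ind by (simp add: independent_differentials_iff z_def)
qed

lemma local_coordinates:
  assumes "x \<in> total_space"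
  shows "\<exists>f. (\<forall>i<4. f i \<in> holomorphic_functions atlas) \<and> independent_differentials atlas 4 f x"
proof (cases "x \<in> patch")
  case False
  then have "swap x \<in> patch" using assms in_patch_or_swap_in_patch by blast
  then obtain f where f: "\<forall>i<4. f i \<in> holomorphic_functions atlas"
      "independent_differentials atlas 4 f (swap x)"
    using local_coordinates_patch by blast
  then show ?thesis
    by (intro exI[of _ "\<lambda>i. f i \<circ> swap"])
      (auto simp: holomorphic_functions_swap independent_differentials_iff comp_assoc)
qed (rule local_coordinates_patch)

lemma Stein_manifold_total_space: "Stein_manifold (top_of_set total_space) atlas"
  unfolding Stein_manifold_def
proof (intro conjI ballI allI impI)
  show "\<exists>f\<in>holomorphic_functions atlas. f x \<noteq> f y" if "x \<noteq> y" for x y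
  proof -
    obtain i where "x $ i \<noteq> y $ i" using \<open>x \<noteq> y\<close> by (auto simp: vec_eq_iff)
    then show ?thesis by (rule bexI[OF _ holomorphic_functions_nth])
  qed
  show "\<exists>f. (\<forall>i<CARD(4). f i \<in> holomorphic_functions atlas) \<and>
      independent_differentials atlas CARD(4) f x"
    if "x \<in> topspace (top_of_set total_space)" for x
    using local_coordinates that by simp
qed (simp_all only: complex_manifold_total_space compactin_holomorphic_hull)

section \<open>The zero section is a differentiable complete intersection\<close>

lemma C_k_on_Suc_imp: "C_k_on (Suc k) f U \<Longrightarrow> C_k_on k f U"
proof (induction k arbitrary: f)
  case 0
  then show ?case
    by (auto intro!: continuous_at_imp_continuous_on differentiable_imp_continuous_within)
next
  case (Suc k)
  then have "f differentiable (at z)" if "z \<in> U" for z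
    using that by simp
  moreover have "C_k_on k (\<lambda>z. frechet_derivative f (at z) v) U" for v
    using Suc.prems Suc.IH[of "\<lambda>z. frechet_derivative f (at z) v"] by simp
  ultimately show ?case by simp
qed

lemma C_k_on_const: "C_k_on k (\<lambda>z. c) U"
  by (induction k arbitrary: c) (simp_all add: frechet_derivative_const)

lemma C_k_on_bounded_linear:
  assumes "bounded_linear f"
  shows "C_k_on k f U"
proof (cases k)
  case 0
  then show ?thesis
    using linear_continuous_on[OF assms] by simp
next
  case (Suc n)
  have d: "(f has_derivative f) (at z)" for z
    by (rule bounded_linear_imp_has_derivative[OF assms])
  then have "f differentiable (at z)" for z
    unfolding differentiable_def by blast
  then show ?thesis
    using Suc by (simp add: frechet_derivative_at[OF d, symmetric] C_k_on_const)
qed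

lemma C_k_on_add:
  "C_k_on k f UNIV \<Longrightarrow> C_k_on k g UNIV \<Longrightarrow> C_k_on k (\<lambda>z. f z + g z) UNIV"
proof (induction k arbitrary: f g)
  case (Suc k)
  have f: "(f has_derivative frechet_derivative f (at z)) (at z)"
    and g: "(g has_derivative frechet_derivative g (at z)) (at z)" for z
    using Suc.prems by (auto simp flip: frechet_derivative_works)
  have fg: "((\<lambda>z. f z + g z) has_derivative
      (\<lambda>v. frechet_derivative f (at z) v + frechet_derivative g (at z) v)) (at z)" for z
    by (rule has_derivative_add[OF f g])
  then have "(\<lambda>z. f z + g z) differentiable (at z)" for z
    unfolding differentiable_def by blast
  then show ?case
    using Suc by (simp add: frechet_derivative_at[OF fg, symmetric])
qed (simp add: continuous_on_add)

lemma C_k_on_mult: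
  "C_k_on k f UNIV \<Longrightarrow> C_k_on k g UNIV \<Longrightarrow> C_k_on k (\<lambda>z. f z * g z) UNIV"
proof (induction k arbitrary: f g)
  case (Suc k)
  have f: "(f has_derivative frechet_derivative f (at z)) (at z)"
    and g: "(g has_derivative frechet_derivative g (at z)) (at z)" for z
    using Suc.prems by (auto simp flip: frechet_derivative_works)
  have fg: "((\<lambda>z. f z * g z) has_derivative
      (\<lambda>v. f z * frechet_derivative g (at z) v + frechet_derivative f (at z) v * g z)) (at z)" for z
    by (rule has_derivative_mult[OF f g])
  then have "(\<lambda>z. f z * g z) differentiable (at z)" for z
    unfolding differentiable_def by blast
  \<comment> \<open>The product rule leaves one factor undifferentiated, so the induction hypothesis
    is applied to f and g themselves at the lower order.\<close>
  moreover have "C_k_on k f UNIV" "C_k_on k g UNIV"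
    using Suc.prems by (simp_all only: C_k_on_Suc_imp)
  ultimately show ?case
    using Suc by (simp add: frechet_derivative_at[OF fg, symmetric] C_k_on_add)
qed (simp add: continuous_on_mult)

text \<open>\<open>C_k_on\<close> concerns real-valued functions, whereas the equations are
  polynomials in the coordinates and their conjugates. Tracking both parts together gives a class
  closed under products and \<open>cnj\<close>.\<close>

definition smooth_complex :: "('e::euclidean_space \<Rightarrow> complex) \<Rightarrow> bool" where
  "smooth_complex f \<longleftrightarrow>
     (\<forall>k. C_k_on k (\<lambda>z. Re (f z)) UNIV \<and> C_k_on k (\<lambda>z. Im (f z)) UNIV)"

lemma smooth_complex_const: "smooth_complex (\<lambda>z. c)"
  by (simp add: smooth_complex_def C_k_on_const)

lemma smooth_complex_nth: "smooth_complex (\<lambda>z :: complex^'n. z $ i)"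
  unfolding smooth_complex_def
  by (intro allI conjI C_k_on_bounded_linear bounded_linear_compose[OF bounded_linear_Re]
      bounded_linear_compose[OF bounded_linear_Im] bounded_linear_vec_nth)

lemma smooth_complex_add:
  "smooth_complex f \<Longrightarrow> smooth_complex g \<Longrightarrow> smooth_complex (\<lambda>z. f z + g z)"
  by (simp add: smooth_complex_def C_k_on_add)

lemma C_k_on_uminus: "C_k_on k f UNIV \<Longrightarrow> C_k_on k (\<lambda>z. - f z) UNIV"
  using C_k_on_mult[OF C_k_on_const[of k "-1"]] by simp

lemma C_k_on_diff: "C_k_on k f UNIV \<Longrightarrow> C_k_on k g UNIV \<Longrightarrow> C_k_on k (\<lambda>z. f z - g z) UNIV"
  using C_k_on_add[OF _ C_k_on_uminus] by simp

lemma smooth_complex_mult: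
  "smooth_complex f \<Longrightarrow> smooth_complex g \<Longrightarrow> smooth_complex (\<lambda>z. f z * g z)"
  by (simp add: smooth_complex_def C_k_on_add C_k_on_diff C_k_on_mult)

lemma smooth_complex_cnj: "smooth_complex f \<Longrightarrow> smooth_complex (\<lambda>z. cnj (f z))"
  by (simp add: smooth_complex_def C_k_on_uminus)

lemma smooth_complex_uminus: "smooth_complex f \<Longrightarrow> smooth_complex (\<lambda>z. - f z)"
  by (simp add: smooth_complex_def C_k_on_uminus)

lemma smooth_complex_diff:
  "smooth_complex f \<Longrightarrow> smooth_complex g \<Longrightarrow> smooth_complex (\<lambda>z. f z - g z)"
  by (simp add: smooth_complex_def C_k_on_diff)

lemmas smooth_complex_intros =
  smooth_complex_const smooth_complex_nth smooth_complex_add smooth_complex_mult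
  smooth_complex_cnj smooth_complex_uminus smooth_complex_diff

text \<open>The real part is twice the upper left entry of the Hermitian matrix described below; the
  bracket is real, so \<open>Re\<close> replaces x$9 by Re t. Likewise \<open>herm_off\<close> is
  twice the upper right entry.\<close>

definition herm_diag :: "complex^9 \<Rightarrow> complex" where
  "herm_diag x = 4 * x$5 +
     x$9 * (x$1 * cnj (x$1) + x$2 * cnj (x$2) - x$3 * cnj (x$3) - x$4 * cnj (x$4))"

definition herm_off :: "complex^9 \<Rightarrow> complex" where
  "herm_off x = 2 * (x$6 + cnj (x$7)) +
     (x$9 + cnj (x$9)) * (x$1 * cnj (x$3) + x$2 * cnj (x$4))"

text \<open>Together with \<open>Im t\<close>, these are the entries of twice the traceless Hermitian matrix
  \<open>A + A\<^sup>* + Re t (P P\<^sup>* - tr (P P\<^sup>*) / 2)\<close>.  Its two summands are orthogonal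
  because \<open>A\<close> maps into the image of \<open>P\<close> and vanishes on it, so the matrix determines \<open>A\<close>
  and \<open>Re t\<close>.\<close>

definition real_equations :: "nat \<Rightarrow> complex^9 \<Rightarrow> real" where
  "real_equations i x =
     [Im (x$9), Re (herm_diag x), Re (herm_off x), Im (herm_off x)] ! i"

definition swap_sign :: "nat \<Rightarrow> real" where
  "swap_sign i = [1, -1, 1, -1] ! i"

text \<open>Conjugation by the transposition exchanges the diagonal entries of a traceless Hermitian
  matrix, hence negates them, and conjugates the off-diagonal entry. That A is traceless too is what
  makes this visible in the formulas.\<close>

lemma real_equations_swap:
  assumes "i < 4" "x \<in> total_space"
  shows "real_equations i (swap x) = swap_sign i * real_equations i x"
proof -
  have eqs: "x$1 * x$5 + x$2 * x$7 = x$5" "x$3 * x$6 + x$4 * x$8 = x$8"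
    "x$5 * x$1 + x$6 * x$3 = 0" "x$7 * x$2 + x$8 * x$4 = 0"
    using assms(2) by (simp_all add: total_space_def)
  \<comment> \<open>This is tr (P A) = tr (A P). The left side is tr A because P A = A, and the
    right side is 0 because A P = 0.\<close>
  have "(x$1 * x$5 + x$2 * x$7) + (x$3 * x$6 + x$4 * x$8) =
      (x$5 * x$1 + x$6 * x$3) + (x$7 * x$2 + x$8 * x$4)"
    by (simp add: algebra_simps)
  then have "x$5 + x$8 = 0"
    by (simp only: eqs) simp
  then have "x$8 = - x$5"
    by (simp add: eq_neg_iff_add_eq_0 add.commute)
  then have "herm_diag (swap x) = - herm_diag x" "herm_off (swap x) = cnj (herm_off x)"
    by (simp_all add: herm_diag_def herm_off_def swap_def algebra_simps)
  then show ?thesis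
    using assms(1)
    by (auto simp: real_equations_def swap_sign_def eval_nat_numeral less_Suc_eq)
      (simp_all add: swap_def)
qed

lemma smooth_real_equations:
  assumes "i < 4"
  shows "C_k_on k (\<lambda>z. real_equations i (param z)) UNIV"
proof -
  have "smooth_complex (\<lambda>z. param z $ 9)" "smooth_complex (\<lambda>z. herm_diag (param z))"
    "smooth_complex (\<lambda>z. herm_off (param z))"
    by (simp_all add: herm_diag_def herm_off_def param_def smooth_complex_intros)
  then show ?thesis
    using assms unfolding smooth_complex_def real_equations_def
    by (auto simp: eval_nat_numeral less_Suc_eq)
qed

lemma frechet_derivative_cmult:
  fixes f :: "'a::real_normed_vector \<Rightarrow> real"
  assumes "f differentiable (at z)"
  shows "frechet_derivative (\<lambda>z. c * f z) (at z) v = c * frechet_derivative f (at z) v"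
proof -
  have "((\<lambda>z. c * f z) has_derivative (\<lambda>v. c * frechet_derivative f (at z) v)) (at z)"
    using assms by (intro has_derivative_mult_right) (simp add: frechet_derivative_works)
  then show ?thesis by (simp add: frechet_derivative_at[symmetric])
qed

text \<open>The equations in a chart, with u = p + i q, w = x + i y and r = Re t times the squared
  norm of the first row of P. The column of r is orthogonal to the other two for the weights 1, 4,
  4: the normal and tangential parts separate.\<close>

lemma normal_frame_kernel:
  fixes p q r x y :: real
  assumes A: "(1 - p\<^sup>2 - q\<^sup>2) * r - 4 * p * x + 4 * q * y = 0"
    and B: "p * r + (1 - p\<^sup>2 + q\<^sup>2) * x + 2 * p * q * y = 0"
    and C: "- q * r + 2 * p * q * x + (1 + p\<^sup>2 - q\<^sup>2) * y = 0"
  shows "r = 0 \<and> x = 0 \<and> y = 0"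
proof -
  have pos: "1 + p\<^sup>2 + q\<^sup>2 > 0"
    by (simp add: add_pos_nonneg)
  \<comment> \<open>The weighted inner product with the column (1 - p^2 - q^2, p, -q), whose
    weighted squared length is (1 + p^2 + q^2)^2.\<close>
  have "(1 + p\<^sup>2 + q\<^sup>2)\<^sup>2 * r =
    (1 - p\<^sup>2 - q\<^sup>2) * ((1 - p\<^sup>2 - q\<^sup>2) * r - 4 * p * x + 4 * q * y) +
    4 * (p * (p * r + (1 - p\<^sup>2 + q\<^sup>2) * x + 2 * p * q * y) -
      q * (- q * r + 2 * p * q * x + (1 + p\<^sup>2 - q\<^sup>2) * y))"
    by (simp add: algebra_simps power2_eq_square power4_eq_xxxx)
  then have "(1 + p\<^sup>2 + q\<^sup>2)\<^sup>2 * r = 0" by (simp only: A B C) simp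
  then have r: "r = 0" using pos by simp
  have pq: "p * x = q * y" using A r by simp
  have "(1 + p\<^sup>2 + q\<^sup>2) * x = p * r + (1 - p\<^sup>2 + q\<^sup>2) * x + 2 * p * q * y"
    unfolding r using pq by algebra
  then have "x = 0" using B pos by simp
  have "(1 + p\<^sup>2 + q\<^sup>2) * y = - q * r + 2 * p * q * x + (1 + p\<^sup>2 - q\<^sup>2) * y"
    unfolding r using pq by algebra
  then have "y = 0" using C pos by simp
  show ?thesis using r \<open>x = 0\<close> \<open>y = 0\<close> by simp
qed

text \<open>The transposed system, up to scaling, since a relation between differentials is a
  relation between rows. The combinations B + p A and C - q A express b and c through a.\<close>

lemma normal_frame_transpose_kernel:
  fixes p q a b c :: real
  assumes A: "(1 - p\<^sup>2 - q\<^sup>2) * a + 2 * p * b - 2 * q * c = 0"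
    and B: "- 2 * p * a + (1 - p\<^sup>2 + q\<^sup>2) * b + 2 * p * q * c = 0"
    and C: "2 * q * a + 2 * p * q * b + (1 + p\<^sup>2 - q\<^sup>2) * c = 0"
  shows "a = 0 \<and> b = 0 \<and> c = 0"
proof -
  have pos: "1 + p\<^sup>2 + q\<^sup>2 > 0"
    by (simp add: add_pos_nonneg)
  have "(1 + p\<^sup>2 + q\<^sup>2) * (b - p * a) = 0" using A B by algebra
  then have b: "b = p * a" using pos by simp
  have "(1 + p\<^sup>2 + q\<^sup>2) * (c + q * a) = 0" using A C by algebra
  then have c: "c = - (q * a)" using pos by simp
  have "(1 + p\<^sup>2 + q\<^sup>2) * a = 0" using A unfolding b c by algebra
  then show ?thesis using b c pos by simp
qed

text \<open>The squared norm of the first row of P. As P is the column (1, u) times that row, P P^H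
  is this number times the projector-like matrix (1, u) (1, u)^H.\<close>

definition row_norm :: "complex^4 \<Rightarrow> real" where
  "row_norm z = (norm (1 - z$1 * z$2))\<^sup>2 + (norm (z$2))\<^sup>2"

lemma row_norm_pos: "row_norm z > 0"
proof (cases "z$2 = 0")
  case True
  then show ?thesis by (simp add: row_norm_def)
next
  case False
  then show ?thesis by (simp add: row_norm_def add_nonneg_pos)
qed

lemma herm_diag_param:
  "herm_diag (param z) = - 4 * z$1 * z$3 + z$4 * row_norm z * (1 - z$1 * cnj (z$1))"
  unfolding row_norm_def of_real_add complex_norm_square
  by (simp add: herm_diag_def param_def algebra_simps)

lemma herm_off_param:
  "herm_off (param z) = 2 * (z$3 - cnj (z$1 * z$1 * z$3)) +
     (z$4 + cnj (z$4)) * row_norm z * cnj (z$1)"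
  unfolding row_norm_def of_real_add complex_norm_square
  by (simp add: herm_off_def param_def algebra_simps)

lemma real_equations_param:
  assumes "z$1 = Complex p q" "z$3 = Complex x y" "z$4 = Complex s t"
  shows "real_equations 0 (param z) = t"
    and "real_equations 1 (param z) = (1 - p\<^sup>2 - q\<^sup>2) * (s * row_norm z) - 4 * p * x + 4 * q * y"
    and "real_equations 2 (param z) =
      2 * (p * (s * row_norm z) + (1 - p\<^sup>2 + q\<^sup>2) * x + 2 * p * q * y)"
    and "real_equations 3 (param z) =
      2 * (- q * (s * row_norm z) + 2 * p * q * x + (1 + p\<^sup>2 - q\<^sup>2) * y)"
  unfolding real_equations_def herm_diag_param herm_off_param assms
  by (simp_all add: param_def assms algebra_simps power2_eq_square)

lemma real_equations_param_zero:
  "(\<forall>i<4. real_equations i (param z) = 0) \<longleftrightarrow> z$3 = 0 \<and> z$4 = 0"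
proof -
  obtain p q x y s t where z: "z$1 = Complex p q" "z$3 = Complex x y" "z$4 = Complex s t"
    by (meson complex.exhaust)
  note e = real_equations_param[OF z]
  show ?thesis
    unfolding all_less_4 e
    using normal_frame_kernel[of p q "s * row_norm z" x y] row_norm_pos[of z] z
    by (auto simp: Complex_eq_0)
qed

lemma real_equations_zero:
  "zero_section = {x \<in> topspace (top_of_set total_space). \<forall>i<4. real_equations i x = 0}"
proof -
  have 0: "x \<in> zero_section \<longleftrightarrow> (\<forall>i<4. real_equations i x = 0)" if "x \<in> patch" for x
    using param_in_zero_section[of "coord x"] real_equations_param_zero[of "coord x"] that
    by (simp add: param_coord)
  moreover have "x \<in> zero_section \<longleftrightarrow> (\<forall>i<4. real_equations i x = 0)"
    if "swap x \<in> patch" "x \<in> total_space" for x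
  proof -
    have "swap_sign i \<noteq> 0" if "i < 4" for i
      using that by (auto simp: swap_sign_def eval_nat_numeral less_Suc_eq)
    then show ?thesis
      using 0[OF that(1)] that(2) by (auto simp: real_equations_swap)
  qed
  ultimately show ?thesis
    using in_patch_or_swap_in_patch by (auto simp: zero_section_def)
qed

lemma real_equations_differentiable:
  "i < 4 \<Longrightarrow> (\<lambda>z. real_equations i (param z)) differentiable (at z)"
  using smooth_real_equations[of i "Suc 0"] by simp

lemma row_norm_differentiable: "row_norm differentiable (at z)"
proof -
  have "row_norm = (\<lambda>z. Re ((1 - z$1 * z$2) * cnj (1 - z$1 * z$2) + z$2 * cnj (z$2)))"
    by (simp only: fun_eq_iff row_norm_def complex_norm_square[symmetric] of_real_add[symmetric]
        Re_complex_of_real simp_thms)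
  moreover have "smooth_complex (\<lambda>z :: complex^4. (1 - z$1 * z$2) * cnj (1 - z$1 * z$2) + z$2 * cnj (z$2))"
    by (intro smooth_complex_intros)
  ultimately have "C_k_on (Suc 0) row_norm UNIV"
    by (simp only: smooth_complex_def)
  then show ?thesis by simp
qed

lemma real_equations_has_derivative:
  assumes "z$3 = 0" "z$4 = 0"
  defines "p \<equiv> Re (z$1)" and "q \<equiv> Im (z$1)" and "n \<equiv> row_norm z"
  shows "((\<lambda>z. real_equations 0 (param z)) has_derivative (\<lambda>v. Im (v$4))) (at z)"
    and "((\<lambda>z. real_equations 1 (param z)) has_derivative
      (\<lambda>v. (1 - p\<^sup>2 - q\<^sup>2) * (Re (v$4) * n) - 4 * p * Re (v$3) + 4 * q * Im (v$3))) (at z)"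
    and "((\<lambda>z. real_equations 2 (param z)) has_derivative
      (\<lambda>v. 2 * (p * (Re (v$4) * n) + (1 - p\<^sup>2 + q\<^sup>2) * Re (v$3) + 2 * p * q * Im (v$3)))) (at z)"
    and "((\<lambda>z. real_equations 3 (param z)) has_derivative
      (\<lambda>v. 2 * (- q * (Re (v$4) * n) + 2 * p * q * Re (v$3) + (1 + p\<^sup>2 - q\<^sup>2) * Im (v$3)))) (at z)"
proof -
  \<comment> \<open>N may stay abstract: it occurs only multiplied by Re t, which is 0 at the points
    considered.\<close>
  obtain N where N: "(row_norm has_derivative N) (at z)"
    using row_norm_differentiable unfolding differentiable_def by blast
  note e = real_equations_param[OF complex_surj[symmetric] complex_surj[symmetric] complex_surj[symmetric]]
  note intros = derivative_eq_intros has_derivative_nth N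
  show "((\<lambda>z. real_equations 0 (param z)) has_derivative (\<lambda>v. Im (v$4))) (at z)"
    unfolding e by (auto intro!: intros)
  show "((\<lambda>z. real_equations 1 (param z)) has_derivative
      (\<lambda>v. (1 - p\<^sup>2 - q\<^sup>2) * (Re (v$4) * n) - 4 * p * Re (v$3) + 4 * q * Im (v$3))) (at z)"
    unfolding e by (auto intro!: intros simp: assms)
  show "((\<lambda>z. real_equations 2 (param z)) has_derivative
      (\<lambda>v. 2 * (p * (Re (v$4) * n) + (1 - p\<^sup>2 + q\<^sup>2) * Re (v$3) + 2 * p * q * Im (v$3)))) (at z)"
    unfolding e by (auto intro!: intros simp: assms)
  show "((\<lambda>z. real_equations 3 (param z)) has_derivative
      (\<lambda>v. 2 * (- q * (Re (v$4) * n) + 2 * p * q * Re (v$3) + (1 + p\<^sup>2 - q\<^sup>2) * Im (v$3)))) (at z)"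
    unfolding e by (auto intro!: intros simp: assms)
qed

lemma independent_at_real_equations:
  assumes "z$3 = 0" "z$4 = 0"
  shows "independent_at 4 (\<lambda>i z. real_equations i (param z)) z"
  unfolding independent_at_def sum_lessThan_4 all_less_4
    real_equations_has_derivative[OF assms, THEN frechet_derivative_at, symmetric]
proof (intro allI impI)
  define p q n where "p = Re (z$1)" and "q = Im (z$1)" and "n = row_norm z"
  fix c :: "nat \<Rightarrow> real"
  assume "\<forall>v::complex^4. c 0 * Im (v$4) +
    c 1 * ((1 - (Re (z$1))\<^sup>2 - (Im (z$1))\<^sup>2) * (Re (v$4) * row_norm z) - 4 * Re (z$1) * Re (v$3) + 4 * Im (z$1) * Im (v$3)) +
    c 2 * (2 * (Re (z$1) * (Re (v$4) * row_norm z) + (1 - (Re (z$1))\<^sup>2 + (Im (z$1))\<^sup>2) * Re (v$3) + 2 * Re (z$1) * Im (z$1) * Im (v$3))) +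
    c 3 * (2 * (- Im (z$1) * (Re (v$4) * row_norm z) + 2 * Re (z$1) * Im (z$1) * Re (v$3) + (1 + (Re (z$1))\<^sup>2 - (Im (z$1))\<^sup>2) * Im (v$3))) = 0"
  then have *: "c 0 * Im t +
      c 1 * ((1 - p\<^sup>2 - q\<^sup>2) * (Re t * n) - 4 * p * Re w + 4 * q * Im w) +
      c 2 * (2 * (p * (Re t * n) + (1 - p\<^sup>2 + q\<^sup>2) * Re w + 2 * p * q * Im w)) +
      c 3 * (2 * (- q * (Re t * n) + 2 * p * q * Re w + (1 + p\<^sup>2 - q\<^sup>2) * Im w)) = 0" for w t
    unfolding p_def q_def n_def by (elim allE[where x = "vector [0, 0, w, t]"]) simp
  \<comment> \<open>In the instantiations the first argument is t and the second is w, by order of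
    occurrence. The vectors t = 1, w = 1, w = i, t = i are tested in turn.\<close>
  have "n * ((1 - p\<^sup>2 - q\<^sup>2) * c 1 + 2 * p * c 2 - 2 * q * c 3) = 0"
    using *[of 1 0] by (simp add: algebra_simps)
  then have A: "(1 - p\<^sup>2 - q\<^sup>2) * c 1 + 2 * p * c 2 - 2 * q * c 3 = 0"
    using row_norm_pos[of z] by (simp add: n_def)
  have B: "- 2 * p * c 1 + (1 - p\<^sup>2 + q\<^sup>2) * c 2 + 2 * p * q * c 3 = 0"
    using *[of 0 1] by (simp add: algebra_simps)
  have C: "2 * q * c 1 + 2 * p * q * c 2 + (1 + p\<^sup>2 - q\<^sup>2) * c 3 = 0"
    using *[of 0 \<i>] by (simp add: algebra_simps)
  show "c 0 = 0 \<and> c 1 = 0 \<and> c 2 = 0 \<and> c 3 = 0"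
    using *[of \<i> 0] normal_frame_transpose_kernel[OF A B C] by simp
qed

text \<open>In \<open>chart1\<close> each equation is the one in \<open>chart0\<close> times a
  constant sign, which affects neither smoothness nor independence.\<close>

lemma differentiable_complete_intersection_zero_section:
  "differentiable_complete_intersection (top_of_set total_space) atlas 4 zero_section"
  unfolding differentiable_complete_intersection_def
proof (intro exI[of _ real_equations] conjI allI impI ballI)
  have swapped: "(real_equations i \<circ> swap \<circ> param) = (\<lambda>z. swap_sign i * real_equations i (param z))"
    if "i < 4" for i
    using real_equations_swap[OF that] by auto
  show "real_equations i \<in> smooth_functions atlas" if "i < 4" for i
  proof -
    have "C_k_on k (real_equations i \<circ> param) UNIV"
      "C_k_on k (real_equations i \<circ> swap \<circ> param) UNIV" for k
      unfolding swapped[OF that] using smooth_real_equations[OF that]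
      by (simp_all add: o_def C_k_on_mult C_k_on_const)
    then show ?thesis
      unfolding smooth_functions_def atlas_def
      by (simp add: in_chart0 in_chart1 coord_image coord_swap_image[simplified])
  qed
  show "zero_section = {x \<in> topspace (top_of_set total_space). \<forall>i<4. real_equations i x = 0}"
    by (rule real_equations_zero)
  fix x assume x: "x \<in> zero_section"
  have "independent_at 4 (\<lambda>i. real_equations i \<circ> param) (coord y)"
    and "independent_at 4 (\<lambda>i. real_equations i \<circ> swap \<circ> param) (coord y)"
    if "y \<in> patch" "y \<in> zero_section" for y
  proof -
    have ind: "independent_at 4 (\<lambda>i z. real_equations i (param z)) (coord y)"
      using independent_at_real_equations[of "coord y"] that
      by (metis param_coord param_in_zero_section)
    then show "independent_at 4 (\<lambda>i. real_equations i \<circ> param) (coord y)"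
      by (simp add: o_def)
    show "independent_at 4 (\<lambda>i. real_equations i \<circ> swap \<circ> param) (coord y)"
      unfolding independent_at_def
    proof (rule allI, rule impI)
      fix c :: "nat \<Rightarrow> real"
      assume "\<forall>v. (\<Sum>i<4. c i * frechet_derivative (real_equations i \<circ> swap \<circ> param) (at (coord y)) v) = 0"
      then have "\<forall>v. (\<Sum>i<4. (c i * swap_sign i) *
          frechet_derivative (\<lambda>z. real_equations i (param z)) (at (coord y)) v) = 0"
        by (simp add: swapped frechet_derivative_cmult real_equations_differentiable mult.assoc)
      then have "\<forall>i<4. c i * swap_sign i = 0"
        using ind unfolding independent_at_def by (elim allE[where x = "\<lambda>i. c i * swap_sign i"]) blast
      then show "\<forall>i<4. c i = 0"
        by (simp add: all_less_4 swap_sign_def)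
    qed
  qed
  then show "independent_differentials atlas 4 real_equations x"
    using x by (simp add: independent_differentials_iff)
qed

section \<open>The zero section is homotopy equivalent to the sphere\<close>

text \<open>The Bloch sphere: P is half of the identity plus the combination of the three Pauli
  matrices with coefficients y.\<close>

definition hermitian_projector :: "real^3 \<Rightarrow> complex^9" where
  "hermitian_projector y = vector [of_real ((1 + y$3) / 2), Complex (y$1 / 2) (- (y$2 / 2)),
     Complex (y$1 / 2) (y$2 / 2), of_real ((1 - y$3) / 2), 0, 0, 0, 0, 0]"

definition frobenius :: "complex^9 \<Rightarrow> real" where
  "frobenius x = (norm (x$1))\<^sup>2 + (norm (x$2))\<^sup>2 + (norm (x$3))\<^sup>2 + (norm (x$4))\<^sup>2"

text \<open>The point of the sphere whose Hermitian projector is \<open>P P\<^sup>* / tr (P P\<^sup>*)\<close>, that is,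
  the orthogonal projector onto the image of \<open>P\<close>.\<close>

definition image_direction :: "complex^9 \<Rightarrow> real^3" where
  "image_direction x = vector
     [2 * Re (x$3 * cnj (x$1) + x$4 * cnj (x$2)) / frobenius x,
      2 * Im (x$3 * cnj (x$1) + x$4 * cnj (x$2)) / frobenius x,
      ((norm (x$1))\<^sup>2 + (norm (x$2))\<^sup>2 - (norm (x$3))\<^sup>2 - (norm (x$4))\<^sup>2) / frobenius x]"

lemma frobenius_pos:
  assumes "x$1 + x$4 = 1"
  shows "frobenius x > 0"
proof -
  have "x$1 \<noteq> 0 \<or> x$4 \<noteq> 0" using assms by auto
  then have "(norm (x$1))\<^sup>2 > 0 \<or> (norm (x$4))\<^sup>2 > 0" by simp
  then show ?thesis
    unfolding frobenius_def using zero_le_power2[of "norm (x$1)"] zero_le_power2[of "norm (x$2)"]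
      zero_le_power2[of "norm (x$3)"] zero_le_power2[of "norm (x$4)"] by linarith
qed

lemma zero_section_eq:
  "zero_section = {x. x$1 + x$4 = 1 \<and> x$1 * x$4 = x$2 * x$3 \<and>
     x$5 = 0 \<and> x$6 = 0 \<and> x$7 = 0 \<and> x$8 = 0 \<and> x$9 = 0}"
  by (auto simp: zero_section_def total_space_def)

lemma sphere_3: "y \<in> sphere (0 :: real^3) 1 \<longleftrightarrow> (y$1)\<^sup>2 + (y$2)\<^sup>2 + (y$3)\<^sup>2 = 1"
  by (simp add: norm_vec_def L2_set_def sum_3)

lemma hermitian_projector_in_zero_section:
  assumes "y \<in> sphere 0 1"
  shows "hermitian_projector y \<in> zero_section"
proof -
  have "(y$1)\<^sup>2 + (y$2)\<^sup>2 = 1 - (y$3)\<^sup>2"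
    using assms unfolding sphere_3 by simp
  then have "((1 + y$3) / 2) * ((1 - y$3) / 2) = (y$1 / 2)\<^sup>2 + (y$2 / 2)\<^sup>2"
    by (simp add: power_divide field_simps power2_eq_square)
  then show ?thesis
    unfolding zero_section_eq
    by (simp add: hermitian_projector_def complex_eq_iff power2_eq_square field_simps)
qed

lemma frobenius_hermitian_projector:
  assumes "y \<in> sphere 0 1"
  shows "frobenius (hermitian_projector y) = 1"
proof -
  have "(y$1)\<^sup>2 + (y$2)\<^sup>2 + (y$3)\<^sup>2 = 1"
    using assms unfolding sphere_3 by simp
  then show ?thesis
    unfolding frobenius_def hermitian_projector_def vector_9 cmod_power2
    by (simp add: power_divide field_simps power2_eq_square)
qed

lemma image_direction_hermitian_projector:
  assumes "y \<in> sphere 0 1"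
  shows "image_direction (hermitian_projector y) = y"
  unfolding image_direction_def frobenius_hermitian_projector[OF assms] vec_eq_iff forall_3
  unfolding hermitian_projector_def vector_9 cmod_power2
  by (simp add: power_divide field_simps power2_eq_square)

text \<open>Lagrange's identity for the rows (a, b) and (c, d): the two sides differ by the squared
  modulus of a d - b c. Equivalently det (P P^H) = |det P|^2.\<close>

lemma rank_one_norm_identity:
  fixes a b c d :: complex
  assumes "a * d = b * c"
  shows "(a * cnj a + b * cnj b) * (c * cnj c + d * cnj d) =
    (c * cnj a + d * cnj b) * (a * cnj c + b * cnj d)"
proof -
  have "(a * cnj a + b * cnj b) * (c * cnj c + d * cnj d) -
      (c * cnj a + d * cnj b) * (a * cnj c + b * cnj d) = (a * d - b * c) * cnj (a * d - b * c)"
    by (simp add: algebra_simps)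
  then show ?thesis using assms by simp
qed

lemma hermitian_projector_image_direction:
  assumes "x \<in> zero_section"
  defines "s \<equiv> complex_of_real (frobenius x)" and "p \<equiv> hermitian_projector (image_direction x)"
  shows "s \<noteq> 0"
    and "s = x$1 * cnj (x$1) + x$2 * cnj (x$2) + x$3 * cnj (x$3) + x$4 * cnj (x$4)"
    and "p$1 = (x$1 * cnj (x$1) + x$2 * cnj (x$2)) / s"
    and "p$2 = (x$1 * cnj (x$3) + x$2 * cnj (x$4)) / s"
    and "p$3 = (x$3 * cnj (x$1) + x$4 * cnj (x$2)) / s"
    and "p$4 = (x$3 * cnj (x$3) + x$4 * cnj (x$4)) / s"
proof -
  have pos: "frobenius x > 0"
    using assms frobenius_pos by (simp add: zero_section_eq)
  then show "s \<noteq> 0" by (simp add: s_def)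
  show s: "s = x$1 * cnj (x$1) + x$2 * cnj (x$2) + x$3 * cnj (x$3) + x$4 * cnj (x$4)"
    unfolding s_def frobenius_def of_real_add complex_norm_square ..
  define A B where "A = (norm (x$1))\<^sup>2 + (norm (x$2))\<^sup>2" and "B = (norm (x$3))\<^sup>2 + (norm (x$4))\<^sup>2"
  have AB: "complex_of_real A = x$1 * cnj (x$1) + x$2 * cnj (x$2)"
    "complex_of_real B = x$3 * cnj (x$3) + x$4 * cnj (x$4)"
    unfolding A_def B_def of_real_add complex_norm_square by simp_all
  have f: "frobenius x = A + B" by (simp add: frobenius_def A_def B_def)
  have "p$1 = of_real ((1 + (A - B) / (A + B)) / 2)" "p$4 = of_real ((1 - (A - B) / (A + B)) / 2)"
    by (simp_all add: p_def hermitian_projector_def image_direction_def f A_def B_def diff_diff_eq)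
  moreover have "(1 + (A - B) / (A + B)) / 2 = A / (A + B)" "(1 - (A - B) / (A + B)) / 2 = B / (A + B)"
    using pos f by (simp_all add: field_simps)
  ultimately show "p$1 = (x$1 * cnj (x$1) + x$2 * cnj (x$2)) / s"
    "p$4 = (x$3 * cnj (x$3) + x$4 * cnj (x$4)) / s"
    unfolding AB[symmetric] s_def f by simp_all
  define m where "m = x$3 * cnj (x$1) + x$4 * cnj (x$2)"
  have p: "p$3 = Complex (Re m / frobenius x) (Im m / frobenius x)"
    "p$2 = Complex (Re m / frobenius x) (- (Im m / frobenius x))"
    unfolding p_def hermitian_projector_def image_direction_def vector_9 vector_3 m_def[symmetric]
    by simp_all
  then have "p$3 = m / s" by (simp add: complex_eq_iff s_def)
  then show "p$3 = (x$3 * cnj (x$1) + x$4 * cnj (x$2)) / s" by (simp add: m_def)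
  have "p$2 = cnj m / s" using p by (simp add: complex_eq_iff s_def)
  then show "p$2 = (x$1 * cnj (x$3) + x$2 * cnj (x$4)) / s" by (simp add: m_def mult.commute)
qed

text \<open>The determinant of \<open>hermitian_projector y\<close> is (1 - |y|^2) / 4. It vanishes
  here because P P^H is singular along with P.\<close>

lemma image_direction_in_sphere:
  assumes "x \<in> zero_section"
  shows "image_direction x \<in> sphere 0 1"
proof -
  note h = hermitian_projector_image_direction[OF assms]
  let ?y = "image_direction x" and ?p = "hermitian_projector (image_direction x)"
  have "x$1 * x$4 = x$2 * x$3" using assms by (simp add: zero_section_eq)
  then have "?p$1 * ?p$4 = ?p$2 * ?p$3"
    unfolding h(3-6) using rank_one_norm_identity[of "x$1" "x$4" "x$2" "x$3"]
    by (simp add: field_simps)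
  then have "Re (?p$1 * ?p$4) = Re (?p$2 * ?p$3)" by simp
  then have "(?y$1)\<^sup>2 + (?y$2)\<^sup>2 + (?y$3)\<^sup>2 = 1"
    by (simp add: hermitian_projector_def field_simps power2_eq_square)
  then show ?thesis unfolding sphere_3 .
qed

text \<open>Two projectors with the same image span an affine line of projectors with that image.\<close>

lemma segment_in_zero_section:
  assumes x: "x \<in> zero_section"
  shows "closed_segment (hermitian_projector (image_direction x)) x \<subseteq> zero_section"
proof
  fix y assume y: "y \<in> closed_segment (hermitian_projector (image_direction x)) x"
  define p where "p = hermitian_projector (image_direction x)"
  note h = hermitian_projector_image_direction[OF x, folded p_def]
  have p: "p \<in> zero_section"
    unfolding p_def by (intro hermitian_projector_in_zero_section image_direction_in_sphere x)
  obtain t :: real where y: "y = (1 - t) *\<^sub>R p + t *\<^sub>R x"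
    using y unfolding p_def closed_segment_def by blast
  define r where "r = complex_of_real t"
  have y': "y$i = (1 - r) * p$i + r * x$i" for i
    unfolding y r_def vector_add_component vector_scaleR_component
    by (simp add: scaleR_conv_of_real)
  have px: "x$1 + x$4 = 1" "x$1 * x$4 = x$2 * x$3" "p$1 + p$4 = 1" "p$1 * p$4 = p$2 * p$3"
    using x p by (auto simp: zero_section_eq)
  \<comment> \<open>The polarized determinant is tr (adj(x) p) for the 2x2 blocks. With p = x x^H /
    tr (x x^H) and adj(x) x = det x, it becomes det x times the conjugate of tr x, over the squared
    norm.\<close>
  have "x$1 * p$4 + x$4 * p$1 - x$2 * p$3 - x$3 * p$2 =
      (x$1 * x$4 - x$2 * x$3) * (cnj (x$1) + cnj (x$4)) / of_real (frobenius x)"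
    unfolding h(3-6) using h(1) by (simp add: field_simps)
  then have mixed: "x$1 * p$4 + x$4 * p$1 = x$2 * p$3 + x$3 * p$2"
    using px by (simp add: algebra_simps)
  have "y$1 + y$4 = (1 - r) * (p$1 + p$4) + r * (x$1 + x$4)"
    unfolding y' by (simp add: algebra_simps)
  then have tr: "y$1 + y$4 = 1" by (simp add: px)
  have "y$1 * y$4 - y$2 * y$3 = (1 - r) * (1 - r) * (p$1 * p$4 - p$2 * p$3) +
      r * r * (x$1 * x$4 - x$2 * x$3) +
      r * (1 - r) * ((x$1 * p$4 + x$4 * p$1) - (x$2 * p$3 + x$3 * p$2))"
    unfolding y' by (simp add: algebra_simps)
  then have "y$1 * y$4 = y$2 * y$3" by (simp add: px mixed)
  moreover have "y$5 = 0" "y$6 = 0" "y$7 = 0" "y$8 = 0" "y$9 = 0"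
    unfolding y' using x p by (simp_all add: zero_section_eq)
  ultimately show "y \<in> zero_section"
    using tr by (simp add: zero_section_eq)
qed

lemma continuous_on_image_direction: "continuous_on zero_section image_direction"
proof (rule continuous_on_vec)
  have "continuous_on zero_section frobenius"
    unfolding frobenius_def by (intro continuous_intros)
  moreover have "frobenius x \<noteq> 0" if "x \<in> zero_section" for x
    using frobenius_pos[of x] that by (simp add: zero_section_eq)
  ultimately show "continuous_on zero_section (\<lambda>x. image_direction x $ i)" for i
    using exhaust_3[of i]
    by (elim disjE; simp only: image_direction_def vector_3; intro continuous_intros) auto
qed

lemma continuous_on_hermitian_projector: "continuous_on S hermitian_projector"
proof (rule continuous_on_vec)
  show "continuous_on S (\<lambda>x. hermitian_projector x $ i)" for i
    using exhaust_9[of i]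
    by (elim disjE; simp add: hermitian_projector_def Complex_eq; intro continuous_intros) auto
qed

lemma zero_section_homotopy_equivalent_sphere:
  "subtopology (top_of_set total_space) zero_section homotopy_equivalent_space
     top_of_set (sphere (0 :: real^3) 1)"
proof -
  have top: "subtopology (top_of_set total_space) zero_section = top_of_set zero_section"
    by (simp add: subtopology_subtopology zero_section_def Int_absorb1 Collect_mono_iff)
  have c1: "continuous_map (top_of_set zero_section) (top_of_set (sphere 0 1)) image_direction"
    using image_direction_in_sphere continuous_on_image_direction
    by (simp add: continuous_map_in_subtopology image_subset_iff)
  have c2: "continuous_map (top_of_set (sphere 0 1)) (top_of_set zero_section) hermitian_projector"
    using hermitian_projector_in_zero_section continuous_on_hermitian_projector
    by (simp add: continuous_map_in_subtopology image_subset_iff)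
  have "homotopic_with (\<lambda>x. True) (top_of_set zero_section) (top_of_set zero_section)
      (hermitian_projector \<circ> image_direction) id"
    using segment_in_zero_section
    by (intro homotopic_with_linear continuous_on_compose continuous_on_image_direction
        continuous_on_hermitian_projector continuous_on_id) simp_all
  moreover have "homotopic_with (\<lambda>x. True) (top_of_set (sphere 0 1)) (top_of_set (sphere 0 1))
      (image_direction \<circ> hermitian_projector) id"
    using image_direction_hermitian_projector
    by (intro homotopic_with_equal continuous_map_compose[OF c2 c1]) simp_all
  ultimately show ?thesis
    unfolding top homotopy_equivalent_space_def using c1 c2 by blast
qed

section \<open>The zero section is not a holomorphic complete intersection\<close>

lemma frechet_derivative_holomorphic:
  assumes "holomorphic_fun_on F U" "z \<in> U"
  shows "(F has_derivative frechet_derivative F (at z)) (at z)"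
    and "frechet_derivative F (at z) (c *s v) = c * frechet_derivative F (at z) v"
proof -
  obtain D where D: "(F has_derivative D) (at z)" "\<And>c v. D (c *s v) = c * D v"
    using assms unfolding holomorphic_fun_on_def by blast
  have "D = frechet_derivative F (at z)"
    by (rule frechet_derivative_at[OF D(1)])
  then show "(F has_derivative frechet_derivative F (at z)) (at z)"
    and "frechet_derivative F (at z) (c *s v) = c * frechet_derivative F (at z) v"
    using D by auto
qed

lemma has_derivative_line:
  fixes z v :: "complex^'n"
  shows "((\<lambda>s. z + s *s v) has_derivative (\<lambda>h. h *s v)) (at s)"
proof (rule has_derivative_vec)
  show "((\<lambda>s. (z + s *s v) $ i) has_derivative (\<lambda>h. (h *s v) $ i)) (at s)" for i
    by (auto intro!: derivative_eq_intros)
qed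

lemma has_field_derivative_line:
  assumes "holomorphic_fun_on F UNIV"
  shows "((\<lambda>s. F (z + s *s v)) has_field_derivative frechet_derivative F (at (z + s *s v)) v) (at s)"
proof -
  note F = frechet_derivative_holomorphic[OF assms UNIV_I]
  have "((\<lambda>s. F (z + s *s v)) has_derivative
      (\<lambda>h. frechet_derivative F (at (z + s *s v)) (h *s v))) (at s)"
    by (rule has_derivative_compose[OF has_derivative_line F(1)])
  moreover have "(*) (frechet_derivative F (at (z + s *s v)) v) =
      (\<lambda>h. frechet_derivative F (at (z + s *s v)) (h *s v))"
    by (simp add: fun_eq_iff F(2))
  ultimately show ?thesis
    by (simp only: has_field_derivative_def)
qed

text \<open>Cauchy's estimate turns uniform closeness of \<open>F\<close> on nearby complex lines into closeness
  of the derivatives along them.\<close>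

lemma continuous_on_frechet_derivative:
  fixes F :: "complex^'n \<Rightarrow> complex"
  assumes "holomorphic_fun_on F UNIV"
  shows "continuous_on UNIV (\<lambda>z. frechet_derivative F (at z) v)"
  unfolding continuous_on_iff
proof safe
  fix z0 :: "complex^'n" and e :: real
  assume "e > 0"
  define K where "K = cball z0 1 \<times> cball (0::complex) 1"
  have "continuous_on K (\<lambda>p. fst p + snd p *s v)"
    by (rule continuous_on_vec) (auto intro!: continuous_intros)
  then have "continuous_on K (F \<circ> (\<lambda>p. fst p + snd p *s v))"
    by (intro continuous_on_compose
        continuous_on_subset[OF holomorphic_fun_on_imp_continuous_on[OF assms]]) auto
  then have "uniformly_continuous_on K (F \<circ> (\<lambda>p. fst p + snd p *s v))"
    by (rule compact_uniformly_continuous) (simp add: K_def compact_Times)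
  then obtain d where d: "d > 0"
    "\<And>p q. p \<in> K \<Longrightarrow> q \<in> K \<Longrightarrow> dist q p < d \<Longrightarrow>
       dist (F (fst q + snd q *s v)) (F (fst p + snd p *s v)) < e / 2"
    using \<open>e > 0\<close> unfolding uniformly_continuous_on_def o_def
    by (metis half_gt_zero_iff)
  show "\<exists>d>0. \<forall>z\<in>UNIV. dist z z0 < d \<longrightarrow>
      dist (frechet_derivative F (at z) v) (frechet_derivative F (at z0) v) < e"
  proof (intro exI[of _ "min d 1"] conjI ballI impI)
    fix z assume z: "dist z z0 < min d 1"
    define h where "h s = F (z + s *s v) - F (z0 + s *s v)" for s
    have h: "(h has_field_derivative frechet_derivative F (at (z + s *s v)) v -
        frechet_derivative F (at (z0 + s *s v)) v) (at s)" for s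
      unfolding h_def by (intro DERIV_diff has_field_derivative_line assms)
    have "norm ((deriv ^^ 1) h 0) \<le> fact 1 * (e / 2) / 1 ^ 1"
    proof (rule Cauchy_inequality)
      show "h holomorphic_on ball 0 1"
        using h by (intro holomorphic_onI) (meson field_differentiable_at_within field_differentiable_def)
      show "continuous_on (cball 0 1) h"
        by (intro continuous_at_imp_continuous_on ballI DERIV_isCont[OF h])
      fix s :: complex assume "norm (0 - s) = 1"
      then have "dist (F (fst (z, s) + snd (z, s) *s v)) (F (fst (z0, s) + snd (z0, s) *s v)) < e / 2"
        using z by (intro d(2)) (auto simp: K_def dist_commute dist_Pair_Pair)
      then show "norm (h s) \<le> e / 2"
        by (simp add: h_def dist_norm)
    qed simp
    moreover have "deriv h 0 = frechet_derivative F (at z) v - frechet_derivative F (at z0) v"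
      using DERIV_imp_deriv[OF h[of 0]] by simp
    ultimately show "dist (frechet_derivative F (at z) v) (frechet_derivative F (at z0) v) < e"
      using \<open>e > 0\<close> by (simp add: dist_norm)
  qed (use \<open>d > 0\<close> in auto)
qed

text \<open>A nowhere vanishing section of a complex line bundle over the two-sphere with clutching
  function \<open>- u\<^sup>2\<close> on the equator would give a logarithm of \<open>u\<^sup>2\<close> there.\<close>

lemma no_nonvanishing_clutching:
  fixes g h :: "complex \<Rightarrow> complex"
  assumes "continuous_on (cball 0 1) g" "continuous_on (cball 0 1) h"
    and "\<And>u. u \<in> cball 0 1 \<Longrightarrow> g u \<noteq> 0" "\<And>u. u \<in> cball 0 1 \<Longrightarrow> h u \<noteq> 0"
    and clutch: "\<And>u. norm u = 1 \<Longrightarrow> g u = - (u * u) * h (cnj u)"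
  shows False
proof -
  obtain G where G: "continuous_on (cball 0 1) G" "\<And>u. u \<in> cball 0 1 \<Longrightarrow> g u = exp (G u)"
    using continuous_logarithm_on_cball[OF assms(1,3)] by blast
  obtain H where H: "continuous_on (cball 0 1) H" "\<And>u. u \<in> cball 0 1 \<Longrightarrow> h u = exp (H u)"
    using continuous_logarithm_on_cball[OF assms(2,4)] by blast
  \<comment> \<open>The difference of logarithms of the two sides of \<open>clutch\<close> at u =
    cis t: 2 i t comes from u^2 and i pi from the sign. Its values are multiples of 2 pi i, so it is
    constant, yet over one turn the terms with G and H return while the linear term changes by -4 pi
    i.\<close>
  define K where "K t = G (cis t) - H (cis (- t)) - 2 * \<i> * of_real t - \<i> * of_real pi" for t
  have exp_K: "exp (K t) = 1" for t
  proof -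
    have "exp (G (cis t)) = - (cis t * cis t) * exp (H (cis (- t)))"
      using clutch[of "cis t"] G(2)[of "cis t"] H(2)[of "cis (- t)"] by (simp add: cis_cnj)
    moreover have "exp (2 * \<i> * of_real t) = cis t * cis t"
      by (simp add: cis_conv_exp flip: exp_add) (simp add: algebra_simps)
    moreover have "exp (\<i> * of_real pi) = -1"
      by (simp add: exp_pi_i')
    ultimately show ?thesis
      by (simp add: K_def exp_diff)
  qed
  have "K constant_on {0..2 * pi}"
  proof (rule continuous_discrete_range_constant)
    have cis: "continuous_on {0..2 * pi} (\<lambda>t. cis t)" "continuous_on {0..2 * pi} (\<lambda>t. cis (- t))"
      by (intro continuous_intros)+
    have "continuous_on {0..2 * pi} (\<lambda>t. G (cis t))" "continuous_on {0..2 * pi} (\<lambda>t. H (cis (- t)))"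
      by (rule continuous_on_compose2[OF G(1) cis(1)] continuous_on_compose2[OF H(1) cis(2)]; auto)+
    then show "continuous_on {0..2 * pi} K"
      unfolding K_def by (intro continuous_intros)
    fix x assume "x \<in> {0..2 * pi}"
    have "2 * pi \<le> norm (K y - K x)" if "K y \<noteq> K x" for y
    proof (rule ccontr)
      assume "\<not> 2 * pi \<le> norm (K y - K x)"
      then have "\<bar>Im (K y) - Im (K x)\<bar> < 2 * pi"
        using abs_Im_le_cmod[of "K y - K x"] by simp
      then have "K y = K x"
        using exp_complex_eqI[of "K y" "K x"] exp_K by simp
      then show False using that by simp
    qed
    then show "\<exists>e>0. \<forall>y. y \<in> {0..2 * pi} \<and> K y \<noteq> K x \<longrightarrow> e \<le> norm (K y - K x)"
      by (intro exI[of _ "2 * pi"]) auto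
  qed simp
  then have "K 0 = K (2 * pi)"
    unfolding constant_on_def by force
  then show False
    by (simp add: K_def cis.ctr complex_eq_iff)
qed

text \<open>Along Y, the determinant of the map from the normal bundle to C^2 induced by the two
  differentials, in the frame given by the w and t directions. It represents a section of the dual
  of the determinant of the normal bundle.\<close>

definition minor :: "(nat \<Rightarrow> complex^4 \<Rightarrow> complex) \<Rightarrow> complex^4 \<Rightarrow> complex" where
  "minor F z =
     frechet_derivative (F 0) (at z) (axis 3 1) * frechet_derivative (F 1) (at z) (axis 4 1) -
     frechet_derivative (F 0) (at z) (axis 4 1) * frechet_derivative (F 1) (at z) (axis 3 1)"

lemma continuous_on_minor:
  assumes "\<And>i. i < 2 \<Longrightarrow> holomorphic_fun_on (F i) UNIV"
  shows "continuous_on S (minor F)"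
  unfolding minor_def
  by (intro continuous_intros continuous_on_subset[OF continuous_on_frechet_derivative] assms) auto

text \<open>The functions vanish on the plane w = t = 0, so their differentials kill the u and b
  directions and are determined by the two normal partial derivatives. A singular matrix of these
  would yield a linear relation.\<close>

lemma minor_nonzero:
  assumes hol: "\<And>i. i < 2 \<Longrightarrow> holomorphic_fun_on (F i) UNIV"
    and zero: "\<And>i z. i < 2 \<Longrightarrow> z$3 = 0 \<Longrightarrow> z$4 = 0 \<Longrightarrow> F i z = 0"
    and ind: "independent_at 2 F z" and z: "z$3 = 0" "z$4 = 0"
  shows "minor F z \<noteq> 0"
proof
  assume minor: "minor F z = 0"
  let ?D = "\<lambda>i. frechet_derivative (F i) (at z)"
  have along: "?D i (axis j 1) = 0" if "i < 2" "j = 1 \<or> j = 2" for i :: nat and j :: 4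
  proof -
    have "F i (z + s *s axis j 1) = 0" for s
      using that z by (intro zero) (auto simp: axis_def)
    then have "((\<lambda>s. 0) has_field_derivative ?D i (axis j 1)) (at 0)"
      using has_field_derivative_line[OF hol[OF that(1)], of z "axis j 1" 0] by simp
    then show ?thesis
      using DERIV_unique[OF DERIV_const] by metis
  qed
  have D: "?D i v = v$3 * ?D i (axis 3 1) + v$4 * ?D i (axis 4 1)" if "i < 2" for i :: nat and v
  proof -
    note F = frechet_derivative_holomorphic[OF hol[OF that] UNIV_I]
    have "v = v$1 *s axis 1 1 + v$2 *s axis 2 1 + v$3 *s axis 3 1 + v$4 *s axis 4 1"
      by (simp add: vec_eq_4 axis_def)
    then have "?D i v = ?D i (v$1 *s axis 1 1 + v$2 *s axis 2 1 + v$3 *s axis 3 1 + v$4 *s axis 4 1)"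
      by (rule arg_cong)
    also have "\<dots> = v$1 * ?D i (axis 1 1) + v$2 * ?D i (axis 2 1) + v$3 * ?D i (axis 3 1) + v$4 * ?D i (axis 4 1)"
      by (simp only: linear_add[OF has_derivative_linear[OF F(1)]] F(2))
    finally show ?thesis using along that by simp
  qed
  have c: "c 0 = 0 \<and> c 1 = 0"
    if "c 0 * ?D 0 (axis 3 1) + c 1 * ?D 1 (axis 3 1) = 0"
      "c 0 * ?D 0 (axis 4 1) + c 1 * ?D 1 (axis 4 1) = 0" for c :: "nat \<Rightarrow> complex"
  proof -
    have "(\<Sum>i<2. c i * ?D i v) = 0" for v
    proof -
      have "(\<Sum>i<2. c i * ?D i v) = c 0 * ?D 0 v + c 1 * ?D 1 v"
        by (simp add: eval_nat_numeral)
      also have "\<dots> = v$3 * (c 0 * ?D 0 (axis 3 1) + c 1 * ?D 1 (axis 3 1)) +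
          v$4 * (c 0 * ?D 0 (axis 4 1) + c 1 * ?D 1 (axis 4 1))"
        by (subst (1 2) D) (simp_all add: algebra_simps)
      finally show ?thesis using that by simp
    qed
    then show ?thesis
      using ind unfolding independent_at_def by fastforce
  qed
  \<comment> \<open>If the determinant is 0, each column (d0, d1) of normal partials gives the
    relation with coefficients (d1, -d0). Independence makes all four partials vanish, and then (1,
    0) is a nontrivial relation.\<close>
  let ?pair = "\<lambda>a b i :: nat. if i = 0 then a else b :: complex"
  have "?D 1 (axis 3 1) = 0 \<and> ?D 0 (axis 3 1) = 0"
    using c[of "?pair (?D 1 (axis 3 1)) (- ?D 0 (axis 3 1))"] minor
    by (simp add: minor_def algebra_simps)
  moreover have "?D 1 (axis 4 1) = 0 \<and> ?D 0 (axis 4 1) = 0"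
    using c[of "?pair (?D 1 (axis 4 1)) (- ?D 0 (axis 4 1))"] minor
    by (simp add: minor_def algebra_simps)
  ultimately show False
    using c[of "?pair 1 0"] by simp
qed

text \<open>The derivative of \<open>transition\<close> multiplies the w direction by -u^2 and fixes
  the t direction, so the determinant changes by exactly the cocycle of L.\<close>

lemma minor_chart_change:
  assumes hol: "\<And>i. i < 2 \<Longrightarrow> f i \<in> holomorphic_functions atlas"
    and z: "z$1 \<noteq> 0" "z$3 = 0" "z$4 = 0"
  shows "minor (\<lambda>i. f i \<circ> param) z =
    - (z$1 * z$1) * minor (\<lambda>i. f i \<circ> swap \<circ> param) (transition z)"
proof -
  let ?E = "\<lambda>i. frechet_derivative (f i \<circ> swap \<circ> param) (at (transition z))"
  have h: "holomorphic_fun_on (f i \<circ> swap \<circ> param) UNIV" if "i < 2" for i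
    using hol[OF that] by (simp only: holomorphic_functions_iff)
  have chart: "frechet_derivative (f i \<circ> param) (at z) v = ?E i (transition_deriv z v)" if "i < 2" for i v
    using frechet_derivative_chart_change[OF holomorphic_fun_on_imp_differentiable[OF h[OF that] UNIV_I] z(1)] .
  have T: "transition_deriv z (axis 3 1) = (- (z$1 * z$1)) *s axis 3 1"
    "transition_deriv z (axis 4 1) = axis 4 1"
    by (simp_all add: vec_eq_4 transition_deriv_def axis_def)
  have "frechet_derivative (f i \<circ> param) (at z) (axis 3 1) = - (z$1 * z$1) * ?E i (axis 3 1)"
    and "frechet_derivative (f i \<circ> param) (at z) (axis 4 1) = ?E i (axis 4 1)" if "i < 2" for i
    unfolding chart[OF that] T
    by (simp_all only: frechet_derivative_holomorphic(2)[OF h[OF that] UNIV_I])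
  then show ?thesis
    by (simp add: minor_def algebra_simps)
qed

lemma not_holomorphic_complete_intersection_zero_section:
  "\<not> holomorphic_complete_intersection (top_of_set total_space) atlas 2 zero_section"
proof
  assume "holomorphic_complete_intersection (top_of_set total_space) atlas 2 zero_section"
  then obtain f where f: "\<forall>i<2. f i \<in> holomorphic_functions atlas"
    "zero_section = {x \<in> topspace (top_of_set total_space). \<forall>i<2. f i x = 0}"
    "\<forall>x\<in>zero_section. independent_differentials atlas 2 f x"
    unfolding holomorphic_complete_intersection_def by (elim exE conjE) (rule that)
  have hol: "f i \<in> holomorphic_functions atlas" if "i < 2" for i
    using f(1) that by simp
  have zero: "zero_section = {x \<in> total_space. \<forall>i<2. f i x = 0}"
    using f(2) by simp
  have ind: "independent_differentials atlas 2 f x" if "x \<in> zero_section" for x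
    using f(3) that by simp
  \<comment> \<open>A copy of the closed unit disc in each chart of the zero section; the two discs are
    glued along their boundaries to a sphere.\<close>
  define disc :: "complex \<Rightarrow> complex^4" where "disc u = vector [u, cnj u / 2, 0, 0]" for u
  have disc: "disc u $ 1 = u" "disc u $ 3 = 0" "disc u $ 4 = 0" for u
    by (simp_all add: disc_def)
  have disc_zero: "param (disc u) \<in> zero_section" "swap (param (disc u)) \<in> zero_section" for u
    by (simp_all add: param_in_zero_section disc)
  have cont: "continuous_on S disc" for S
  proof (rule continuous_on_vec)
    show "continuous_on S (\<lambda>u. disc u $ i)" for i
      using exhaust_4[of i] by (elim disjE; simp add: disc_def; intro continuous_intros) auto
  qed
  \<comment> \<open>The second coordinate \<open>cnj u / 2\<close> is chosen for this: on the unit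
    circle u b = 1/2, so u (1 - u b) = u / 2, which is again half the conjugate of the new slope
    \<open>cnj u\<close>.\<close>
  have trans: "transition (disc u) = disc (cnj u)" if "norm u = 1" for u
  proof -
    have "u * cnj u = 1" using that complex_norm_square[of u] by simp
    moreover from this have "1 / u = cnj u" by (metis nonzero_mult_div_cancel_left mult_zero_left zero_neq_one)
    ultimately show ?thesis by (simp add: transition_def disc_def vec_eq_4)
  qed
  define F G where "F = (\<lambda>i. f i \<circ> param)" and "G = (\<lambda>i. f i \<circ> swap \<circ> param)"
  have F: "holomorphic_fun_on (F i) UNIV" and G: "holomorphic_fun_on (G i) UNIV" if "i < 2" for i
    using hol[OF that] by (simp_all only: holomorphic_functions_iff F_def G_def)
  have F0: "F i z = 0" and G0: "G i z = 0" if "i < 2" "z$3 = 0" "z$4 = 0" for i z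
  proof -
    have "param z \<in> zero_section" "swap (param z) \<in> zero_section"
      using that by (simp_all add: param_in_zero_section)
    then show "F i z = 0" "G i z = 0"
      using that(1) unfolding zero F_def G_def by auto
  qed
  have Fi: "independent_at 2 F (disc u)" for u
    using ind[OF disc_zero(1)[of u]] by (simp add: independent_differentials_iff F_def)
  have Gi: "independent_at 2 G (disc u)" for u
    using ind[OF disc_zero(2)[of u]] by (simp add: independent_differentials_iff G_def)
  show False
  proof (rule no_nonvanishing_clutching)
    show "continuous_on (cball 0 1) (\<lambda>u. minor F (disc u))"
      by (rule continuous_on_compose2[OF continuous_on_minor[OF F, where S = UNIV] cont]) auto
    show "continuous_on (cball 0 1) (\<lambda>u. minor G (disc u))"
      by (rule continuous_on_compose2[OF continuous_on_minor[OF G, where S = UNIV] cont]) auto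
    show "minor F (disc u) \<noteq> 0" for u
      using F F0 Fi by (rule minor_nonzero) (simp_all add: disc)
    show "minor G (disc u) \<noteq> 0" for u
      using G G0 Gi by (rule minor_nonzero) (simp_all add: disc)
    show "minor F (disc u) = - (u * u) * minor G (disc (cnj u))" if "norm u = 1" for u
    proof -
      have "u \<noteq> 0" using that by auto
      then show ?thesis
        using minor_chart_change[of f "disc u"] hol trans[OF that] by (simp add: disc F_def G_def)
    qed
  qed
qed

(* The type complex^9 only supplies the points of X; its topology and linear structure play no
   role.  A manifold has at most continuum many points, so fixing a carrier type of that
   cardinality loses no generality. *)
theorem mainTheorem6:
  shows "\<exists>(X :: (complex^9) topology) (A :: (complex^9, complex^4) chart set) (Y :: (complex^9) set).
           Stein_manifold X A \<and>
           closed_complex_submanifold X A 2 Y \<and>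
           subtopology X Y homotopy_equivalent_space top_of_set (sphere (0 :: real^3) 1) \<and>
           differentiable_complete_intersection X A 4 Y \<and>
           \<not> holomorphic_complete_intersection X A 2 Y"
  using Stein_manifold_total_space closed_complex_submanifold_zero_section
    zero_section_homotopy_equivalent_sphere differentiable_complete_intersection_zero_section
    not_holomorphic_complete_intersection_zero_section
  by blast

end
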